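(* Let $\Phi=(\phi_j)_{1\le j\le N}$ be a sequence of nonzero elements of a real vector space $F$, generating $F$ and spanning a salient cone $\mathfrak c(\Phi)$. Let $\tau_1$ and $\tau_2$ be adjacent $\Phi$-topes such that $\tau_1\subset\mathfrak c(\Phi)$. Let $H$ be their common wall. Let $A$ be the set of $i\in\{1,\dots,N\}$ such that $\phi_i$ is in the open side of $H$ which contains $\tau_1$. Let $\Phi_{\rm flip}^A$ be the sequence $(\sigma_i^A\phi_i)_{1\le i\le N}$, where $\sigma_i^A=-1$ if $i\in A$ and $\sigma_i^A=1$ if $i\notin A$. Let $X(\Phi,\tau_1)$, $X(\Phi,\tau_2)$ and $X(\Phi_{\rm flip}^A,\tau_2)$ be the corresponding Combinatorial Brianchon-Gram polynomials in $\mathbb Z[p_1,\dots,p_N,q_1,\dots,q_N]$. Let $\operatorname{Flip}_A$ be the ring homomorphism from $\mathbb Z[p_i,q_i]$ to itself which exchanges $p_i$ and $q_i$ for $i\in A$ (and fixes $p_i,q_i$ for $i\notin A$). Then $$X(\Phi,\tau_1)=X(\Phi,\tau_2)-(-1)^{|A|}\operatorname{Flip}_A X(\Phi_{\rm flip}^A,\tau_2).$$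
   Context: $F$ is finite dimensional, $r=\dim F$; $\mathfrak c(\Phi)=\{\sum_i t_i\phi_i:t_i\ge 0\}$; a cone is salient if it contains no affine line. For a sequence $\Psi=(\psi_1,\dots,\psi_N)$ of nonzero vectors generating $F$, a $\Psi$-wall is a hyperplane of $F$ spanned by $r-1$ linearly independent elements of $\Psi$; a $\Psi$-tope is a connected component of the complement in $F$ of the union of all $\Psi$-walls. ($\Phi$ and $\Phi_{\rm flip}^A$ have the same walls and topes.) Two topes are adjacent if the intersection of their closures is contained in a wall and spans this wall, called their common wall. For a tope $\tau$, $\mathcal G(\Psi,\tau)$ is the set of $I\subseteq\{1,\dots,N\}$ such that $\{\psi_i,i\in I\}$ generates $F$ and $\tau$ is contained in the cone generated by $\{\psi_i,i\in I\}$. With $I^c$ the complement of $I$, the Combinatorial Brianchon-Gram polynomial is $$X(\Psi,\tau)=\sum_{I\in\mathcal G(\Psi,\tau)}(-1)^{|I|-\dim F}\prod_{i\in I^c}p_i\prod_{i\in I}(p_i+q_i)$$ (so $X(\Psi,\tau)=0$ if $\tau\not\subset\mathfrak c(\Psi)$). *)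

theory Defs
  imports "HOL-Analysis.Analysis" "HOL-Library.Poly_Mapping"
begin

section \<open>Cones, walls and topes of a sequence of vectors\<close>

text \<open>
  The finite-dimensional space \<open>F\<close> is a type of class \<^class>\<open>euclidean_space\<close>; its inner product
  only serves to provide the topology. A sequence \<open>(\<psi>\<^sub>1, \<dots>, \<psi>\<^sub>N)\<close> is a function \<open>\<psi>\<close> on \<^typ>\<open>nat\<close>, of
  which only the values on \<open>{1..N}\<close> matter.
\<close>

definition generated_cone :: "nat set \<Rightarrow> (nat \<Rightarrow> 'a::real_vector) \<Rightarrow> 'a set" where
  "generated_cone I \<psi> = {\<Sum>i\<in>I. t i *\<^sub>R \<psi> i | t. \<forall>i\<in>I. 0 \<le> t i}"

definition salient :: "'a::real_vector set \<Rightarrow> bool" where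
  "salient C \<longleftrightarrow> \<not> (\<exists>x v. v \<noteq> 0 \<and> (\<forall>t. x + t *\<^sub>R v \<in> C))"

text \<open>As \<open>DIM('a) \<ge> 1\<close>, the subtraction does not truncate. A wall is the zero space if \<open>DIM('a) = 1\<close>.\<close>

definition wall :: "nat \<Rightarrow> (nat \<Rightarrow> 'a::euclidean_space) \<Rightarrow> 'a set \<Rightarrow> bool" where
  "wall N \<psi> H \<longleftrightarrow>
     (\<exists>B. B \<subseteq> \<psi> ` {1..N} \<and> independent B \<and> card B = DIM('a) - 1 \<and> H = span B)"

definition tope :: "nat \<Rightarrow> (nat \<Rightarrow> 'a::euclidean_space) \<Rightarrow> 'a set \<Rightarrow> bool" where
  "tope N \<psi> \<tau> \<longleftrightarrow> \<tau> \<in> components (- \<Union>{H. wall N \<psi> H})"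

definition common_wall :: "nat \<Rightarrow> (nat \<Rightarrow> 'a::euclidean_space) \<Rightarrow> 'a set \<Rightarrow> 'a set \<Rightarrow> 'a set \<Rightarrow> bool" where
  "common_wall N \<psi> \<tau>\<^sub>1 \<tau>\<^sub>2 H \<longleftrightarrow>
     wall N \<psi> H \<and> closure \<tau>\<^sub>1 \<inter> closure \<tau>\<^sub>2 \<subseteq> H \<and> span (closure \<tau>\<^sub>1 \<inter> closure \<tau>\<^sub>2) = H"

definition adjacent :: "nat \<Rightarrow> (nat \<Rightarrow> 'a::euclidean_space) \<Rightarrow> 'a set \<Rightarrow> 'a set \<Rightarrow> bool" where
  "adjacent N \<psi> \<tau>\<^sub>1 \<tau>\<^sub>2 \<longleftrightarrow> (\<exists>H. common_wall N \<psi> \<tau>\<^sub>1 \<tau>\<^sub>2 H)"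

definition open_side :: "'a::real_vector set \<Rightarrow> 'a set \<Rightarrow> bool" where
  "open_side H S \<longleftrightarrow>
     (\<exists>f :: 'a \<Rightarrow> real. linear f \<and> (\<exists>x. f x \<noteq> 0) \<and> H = {x. f x = 0} \<and> S = {x. 0 < f x})"

definition flip_seq :: "nat set \<Rightarrow> (nat \<Rightarrow> 'a::real_vector) \<Rightarrow> nat \<Rightarrow> 'a" where
  "flip_seq A \<psi> i = (if i \<in> A then -1 else 1) *\<^sub>R \<psi> i"

definition generating_sets :: "nat \<Rightarrow> (nat \<Rightarrow> 'a::real_vector) \<Rightarrow> 'a set \<Rightarrow> nat set set" where
  "generating_sets N \<psi> \<tau> =
     {I. I \<subseteq> {1..N} \<and> span (\<psi> ` I) = UNIV \<and> \<tau> \<subseteq> generated_cone I \<psi>}"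


section \<open>The polynomial ring\<close>

text \<open>
  Polynomials with integer coefficients in the variables \<open>p\<^sub>i, q\<^sub>i\<close> for all \<open>i :: nat\<close>; the ring
  \<open>\<int>[p\<^sub>1, \<dots>, p\<^sub>N, q\<^sub>1, \<dots>, q\<^sub>N]\<close> is the subring of those involving only indices in \<open>{1..N}\<close>.
  A monomial is a finitely supported map from variables to exponents, and a polynomial a finitely
  supported map from monomials to coefficients, with the convolution product.
\<close>

datatype pq_var = P nat | Q nat

type_synonym pq_poly = "(pq_var \<Rightarrow>\<^sub>0 nat) \<Rightarrow>\<^sub>0 int"

definition pq_variable :: "pq_var \<Rightarrow> pq_poly" where
  "pq_variable v = Poly_Mapping.single (Poly_Mapping.single v 1) 1"

abbreviation p :: "nat \<Rightarrow> pq_poly" where "p i \<equiv> pq_variable (P i)"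

abbreviation q :: "nat \<Rightarrow> pq_poly" where "q i \<equiv> pq_variable (Q i)"

definition eval_monom :: "(pq_var \<Rightarrow> pq_poly) \<Rightarrow> (pq_var \<Rightarrow>\<^sub>0 nat) \<Rightarrow> pq_poly" where
  "eval_monom f m = (\<Prod>v\<in>Poly_Mapping.keys m. f v ^ Poly_Mapping.lookup m v)"

definition substitute :: "(pq_var \<Rightarrow> pq_poly) \<Rightarrow> pq_poly \<Rightarrow> pq_poly" where
  "substitute f x = (\<Sum>m\<in>Poly_Mapping.keys x. of_int (Poly_Mapping.lookup x m) * eval_monom f m)"

fun swap_pq :: "nat set \<Rightarrow> pq_var \<Rightarrow> pq_var" where
  "swap_pq A (P i) = (if i \<in> A then Q i else P i)"
| "swap_pq A (Q i) = (if i \<in> A then P i else Q i)"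

definition Flip :: "nat set \<Rightarrow> pq_poly \<Rightarrow> pq_poly" where
  "Flip A = substitute (\<lambda>v. pq_variable (swap_pq A v))"

text \<open>\<^const>\<open>Flip\<close> is a ring homomorphism with the prescribed values on the variables.\<close>

lemma eval_monom_superset:
  assumes "finite K" "Poly_Mapping.keys m \<subseteq> K"
  shows "eval_monom f m = (\<Prod>v\<in>K. f v ^ Poly_Mapping.lookup m v)"
  unfolding eval_monom_def using assms
  by (intro prod.mono_neutral_left) (auto simp: in_keys_iff)

lemma eval_monom_add: "eval_monom f (m + n) = eval_monom f m * eval_monom f n"
proof -
  let ?K = "Poly_Mapping.keys m \<union> Poly_Mapping.keys n"
  have "Poly_Mapping.keys (m + n) \<subseteq> ?K" by (rule keys_add)
  then show ?thesis
    by (simp add: eval_monom_superset[of ?K] lookup_add power_add prod.distrib)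
qed

lemma substitute_superset:
  assumes "finite K" "Poly_Mapping.keys x \<subseteq> K"
  shows "substitute f x = (\<Sum>m\<in>K. of_int (Poly_Mapping.lookup x m) * eval_monom f m)"
  unfolding substitute_def using assms
  by (intro sum.mono_neutral_left) (auto simp: in_keys_iff)

lemma substitute_add: "substitute f (x + y) = substitute f x + substitute f y"
proof -
  let ?K = "Poly_Mapping.keys x \<union> Poly_Mapping.keys y"
  have "Poly_Mapping.keys (x + y) \<subseteq> ?K" by (rule keys_add)
  then show ?thesis
    by (simp add: substitute_superset[of ?K] lookup_add distrib_right sum.distrib)
qed

lemma substitute_single: "substitute f (Poly_Mapping.single m c) = of_int c * eval_monom f m"
  by (simp add: substitute_superset[of "{m}"])

lemma poly_eq_sum_single:
  "x = (\<Sum>m\<in>Poly_Mapping.keys x. Poly_Mapping.single m (Poly_Mapping.lookup x m))" for x :: pq_poly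
proof (rule poly_mapping_eqI)
  show "Poly_Mapping.lookup x k = Poly_Mapping.lookup
      (\<Sum>m\<in>Poly_Mapping.keys x. Poly_Mapping.single m (Poly_Mapping.lookup x m)) k" for k
    by (simp add: lookup_sum lookup_single when_def sum.delta in_keys_iff)
qed

lemma substitute_0: "substitute f 0 = 0"
  by (simp add: substitute_def)

lemma substitute_sum: "substitute f (\<Sum>i\<in>S. g i) = (\<Sum>i\<in>S. substitute f (g i))"
  by (induction S rule: infinite_finite_induct) (simp_all add: substitute_0 substitute_add)

lemma substitute_mult: "substitute f (x * y) = substitute f x * substitute f y"
proof -
  let ?s = "\<lambda>x m. Poly_Mapping.single m (Poly_Mapping.lookup x m) :: pq_poly"
  have "x * y = (\<Sum>m\<in>Poly_Mapping.keys x. ?s x m) * (\<Sum>n\<in>Poly_Mapping.keys y. ?s y n)"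
    using poly_eq_sum_single[of x] poly_eq_sum_single[of y] by simp
  also have "\<dots> = (\<Sum>m\<in>Poly_Mapping.keys x. \<Sum>n\<in>Poly_Mapping.keys y. ?s x m * ?s y n)"
    by (rule sum_product)
  finally have "substitute f (x * y) =
      (\<Sum>m\<in>Poly_Mapping.keys x. \<Sum>n\<in>Poly_Mapping.keys y.
        substitute f (?s x m) * substitute f (?s y n))"
    by (simp add: substitute_sum mult_single substitute_single eval_monom_add mult_ac)
  also have "\<dots> = (\<Sum>m\<in>Poly_Mapping.keys x. substitute f (?s x m)) *
      (\<Sum>n\<in>Poly_Mapping.keys y. substitute f (?s y n))"
    by (rule sum_product[symmetric])
  also have "\<dots> = substitute f x * substitute f y"
    unfolding substitute_single by (simp add: substitute_def)
  finally show ?thesis .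
qed

lemma Flip_add: "Flip A (x + y) = Flip A x + Flip A y"
  by (simp add: Flip_def substitute_add)

lemma Flip_mult: "Flip A (x * y) = Flip A x * Flip A y"
  by (simp add: Flip_def substitute_mult)

lemma Flip_1: "Flip A 1 = 1"
  using substitute_single[of _ 0 1] by (simp add: Flip_def eval_monom_def)

lemma Flip_variable: "Flip A (pq_variable v) = pq_variable (swap_pq A v)"
  unfolding Flip_def pq_variable_def[of v] by (simp add: substitute_single eval_monom_def)


section \<open>The combinatorial Brianchon-Gram polynomial\<close>

text \<open>
  As \<open>\<psi> i\<close>, \<open>i \<in> I\<close>, generate the space, \<open>card I \<ge> DIM('a)\<close>, and the subtraction does not truncate.
\<close>

definition BG_poly :: "nat \<Rightarrow> (nat \<Rightarrow> 'a::euclidean_space) \<Rightarrow> 'a set \<Rightarrow> pq_poly" where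
  "BG_poly N \<psi> \<tau> = (\<Sum>I\<in>generating_sets N \<psi> \<tau>.
     (-1) ^ (card I - DIM('a)) * (\<Prod>i\<in>{1..N} - I. p i) * (\<Prod>i\<in>I. p i + q i))"

end

theory Submission
  imports Defs
begin

text \<open>
  Put \<open>X = (-1)\<^sup>d \<Sum>\<^sub>I [\<tau> \<subseteq> c(I)] \<Prod>\<^sub>i\<^sub>\<in>\<^sub>I (-(p\<^sub>i + q\<^sub>i)) \<Prod>\<^sub>i\<^sub>\<notin>\<^sub>I p\<^sub>i\<close>, where \<open>d\<close> is the dimension and
  \<open>c(I)\<close> is the cone generated by the vectors with index in \<open>I\<close>, and ask which index sets \<open>I\<close> tell
  the two sides of the wall \<open>H = {f = 0}\<close> apart, with \<open>f\<close> positive on \<open>\<tau>\<^sub>1\<close>. Let \<open>x \<in> H\<close> lie in the closure of both topes and on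
  no other wall (\<open>common_wall_generic_point\<close>). Let \<open>K\<close>, \<open>A\<close>, \<open>C\<close> be the sets of indices for which \<open>f\<close>
  is zero, positive, negative.

  By Caratheodory's theorem, a cone \<open>c(I)\<close> containing \<open>\<tau>\<^sub>1\<close> contains it already in a simplicial cone
  \<open>c(J)\<close>, whose facets span walls. If \<open>x \<notin> c(I \<inter> K)\<close>, then \<open>x\<close> is on no facet of \<open>c(J)\<close>, hence in its
  interior, so that \<open>c(I)\<close> contains \<open>\<tau>\<^sub>2\<close> too. If \<open>x \<in> c(I \<inter> K)\<close>, then \<open>x\<close> is in the interior of that
  cone relative to \<open>H\<close>, and \<open>c(I)\<close> contains \<open>\<tau>\<^sub>1\<close> exactly if \<open>I\<close> meets \<open>A\<close>, and \<open>\<tau>\<^sub>2\<close> exactly if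
  \<open>I\<close> meets \<open>C\<close>. Therefore (\<open>indicator_jump\<close>)
  \<open>[\<tau>\<^sub>1 \<subseteq> c(I)] - [\<tau>\<^sub>2 \<subseteq> c(I)] = [x \<in> c(I \<inter> K)] ([I \<inter> C = \<emptyset>] - [I \<inter> A = \<emptyset>])\<close>.

  Both summands on the right and the product over \<open>i\<close> factor along \<open>K \<union> A \<union> C\<close>. As the terms for all subsets of \<open>A\<close>
  add up to \<open>\<Prod>\<^sub>i\<^sub>\<in>\<^sub>A (p\<^sub>i - (p\<^sub>i + q\<^sub>i)) = \<Prod>\<^sub>i\<^sub>\<in>\<^sub>A (-q\<^sub>i)\<close>, this gives \<open>BG_poly_jump\<close>:
  \<open>X(\<tau>\<^sub>1) - X(\<tau>\<^sub>2) = (-1)\<^sup>d Z ((-q)\<^sub>A p\<^sub>C - p\<^sub>A (-q)\<^sub>C)\<close>, where \<open>Z\<close> depends only on \<open>x\<close> and on the vectors in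
  \<open>H\<close>.

  The flipped sequence has the same walls and topes, the same point \<open>x\<close> and the same \<open>Z\<close>, but all its
  vectors outside \<open>H\<close> are on the side of \<open>\<tau>\<^sub>2\<close>. So its polynomial for \<open>\<tau>\<^sub>1\<close> is zero, and the same
  formula, applied with the empty set for \<open>A\<close> and with \<open>A \<union> C\<close> for \<open>C\<close>, computes its polynomial for
  \<open>\<tau>\<^sub>2\<close> as \<open>-(-1)\<^sup>d Z (p\<^sub>A p\<^sub>C - (-q)\<^sub>A (-q)\<^sub>C)\<close>. Exchanging \<open>p\<^sub>i\<close> and \<open>q\<^sub>i\<close> for \<open>i \<in> A\<close> and multiplying by
  \<open>-(-1)\<^bsup>|A|\<^esup>\<close> gives back the jump \<open>X(\<tau>\<^sub>1) - X(\<tau>\<^sub>2)\<close>.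
\<close>


section \<open>Linear independence of families of vectors\<close>

text \<open>
  Independence is stated for the family, so that two indices with equal vectors count as dependent,
  and so that its invariance under a change of signs is evident.
\<close>

definition independent_family :: "nat set \<Rightarrow> (nat \<Rightarrow> 'a::real_vector) \<Rightarrow> bool" where
  "independent_family J \<psi> \<longleftrightarrow> (\<forall>u. (\<Sum>j\<in>J. u j *\<^sub>R \<psi> j) = 0 \<longrightarrow> (\<forall>j\<in>J. u j = 0))"

lemma independent_family_iff:
  assumes "finite J"
  shows "independent_family J \<psi> \<longleftrightarrow> inj_on \<psi> J \<and> independent (\<psi> ` J)"
proof
  assume ind: "independent_family J \<psi>"
  have inj: "inj_on \<psi> J"
  proof (rule inj_onI, rule ccontr)
    fix i j assume ij: "i \<in> J" "j \<in> J" "\<psi> i = \<psi> j" "i \<noteq> j"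
    let ?u = "\<lambda>k. if k = i then 1 else if k = j then - 1 else (0::real)"
    have "(\<Sum>k\<in>J. ?u k *\<^sub>R \<psi> k) = (\<Sum>k\<in>{i, j}. ?u k *\<^sub>R \<psi> k)"
      using assms ij(1,2) by (intro sum.mono_neutral_right) auto
    also have "\<dots> = 0" using ij(3,4) by simp
    finally have sum0: "(\<Sum>k\<in>J. ?u k *\<^sub>R \<psi> k) = 0" .
    have "?u i = 0"
      using ind[unfolded independent_family_def, rule_format, OF sum0 ij(1)] .
    then show False using ij by simp
  qed
  moreover have "independent (\<psi> ` J)"
  proof (rule independent_if_scalars_zero)
    fix f x assume f: "(\<Sum>x\<in>\<psi> ` J. f x *\<^sub>R x) = 0" and x: "x \<in> \<psi> ` J"
    have "(\<Sum>j\<in>J. f (\<psi> j) *\<^sub>R \<psi> j) = 0" using f by (simp add: sum.reindex[OF inj])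
    then have "\<forall>j\<in>J. f (\<psi> j) = 0"
      using ind[unfolded independent_family_def, THEN spec, of "\<lambda>j. f (\<psi> j)"] by blast
    then show "f x = 0" using x by blast
  qed (use assms in simp)
  ultimately show "inj_on \<psi> J \<and> independent (\<psi> ` J)" by blast
next
  assume J: "inj_on \<psi> J \<and> independent (\<psi> ` J)"
  show "independent_family J \<psi>"
    unfolding independent_family_def
  proof (intro allI impI ballI)
    fix u j assume u: "(\<Sum>j\<in>J. u j *\<^sub>R \<psi> j) = 0" and j: "j \<in> J"
    have "(\<Sum>v\<in>\<psi> ` J. u (the_inv_into J \<psi> v) *\<^sub>R v) = 0"
      using J u by (simp add: sum.reindex the_inv_into_f_f)
    then have "u (the_inv_into J \<psi> (\<psi> j)) = 0"
      using independentD[of "\<psi> ` J" "\<psi> ` J" "\<lambda>v. u (the_inv_into J \<psi> v)"] J j assms by simp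
    then show "u j = 0" using J j by (simp add: the_inv_into_f_f)
  qed
qed


section \<open>Generated cones\<close>

lemma generated_coneI:
  assumes "y = (\<Sum>i\<in>I. t i *\<^sub>R \<psi> i)" "\<And>i. i \<in> I \<Longrightarrow> 0 \<le> t i"
  shows "y \<in> generated_cone I \<psi>"
  unfolding generated_cone_def using assms by blast

text \<open>
  Caratheodory's theorem for cones: if the family is dependent, subtracting a multiple of a linear
  relation from the coefficients brings one of them to zero and keeps the others nonnegative, so
  that its index can be left out.
\<close>

lemma cone_caratheodory:
  assumes "finite I" "y \<in> generated_cone I \<psi>"
  shows "\<exists>J\<subseteq>I. independent_family J \<psi> \<and> y \<in> generated_cone J \<psi>"
  using assms
proof (induction "card I" arbitrary: I rule: less_induct)
  case less
  show ?case
  proof (cases "independent_family I \<psi>")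
    case True
    then show ?thesis using less.prems by blast
  next
    case False
    then obtain u where u: "(\<Sum>j\<in>I. u j *\<^sub>R \<psi> j) = 0" "\<exists>j\<in>I. u j \<noteq> 0"
      unfolding independent_family_def by blast
    obtain u where u: "(\<Sum>j\<in>I. u j *\<^sub>R \<psi> j) = 0" "\<exists>j\<in>I. 0 < u j"
    proof (cases "\<exists>j\<in>I. 0 < u j")
      case True
      then show ?thesis using u that by blast
    next
      case False
      then have "\<exists>j\<in>I. 0 < - u j" using u(2) by (metis neg_0_less_iff_less linorder_neqE)
      moreover have "(\<Sum>j\<in>I. - u j *\<^sub>R \<psi> j) = 0" using u(1) by (simp add: sum_negf)
      ultimately show ?thesis using that[of "\<lambda>j. - u j"] by blast
    qed
    obtain t where t: "y = (\<Sum>i\<in>I. t i *\<^sub>R \<psi> i)" "\<forall>i\<in>I. 0 \<le> t i"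
      using less.prems(2) unfolding generated_cone_def by blast
    obtain k where k: "k \<in> I" "0 < u k" "\<And>i. i \<in> I \<Longrightarrow> 0 < u i \<Longrightarrow> t k / u k \<le> t i / u i"
    proof -
      let ?P = "{i \<in> I. 0 < u i}"
      have "finite ?P" "?P \<noteq> {}" using u less.prems(1) by auto
      then obtain k where "k \<in> ?P" "\<And>i. i \<in> ?P \<Longrightarrow> t k / u k \<le> t i / u i"
        using arg_min_if_finite[of ?P "\<lambda>i. t i / u i"] by (meson not_le)
      then show ?thesis using that by blast
    qed
    \<comment> \<open>The largest multiple of the relation that can be subtracted.\<close>
    define m where "m = t k / u k"
    have m0: "0 \<le> m" unfolding m_def using t(2) k by simp
    let ?t = "\<lambda>i. t i - m * u i"
    have nonneg: "0 \<le> ?t i" if "i \<in> I" for i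
    proof (cases "0 < u i")
      case True
      then show ?thesis using k(3)[OF that True] unfolding m_def[symmetric] by (simp add: pos_le_divide_eq)
    next
      case False
      then have "m * u i \<le> 0" using m0 by (simp add: mult_nonneg_nonpos)
      then show ?thesis using t(2) that by fastforce
    qed
    have tk: "?t k = 0" using k(2) unfolding m_def by simp
    have "(\<Sum>i\<in>I. ?t i *\<^sub>R \<psi> i) = y - m *\<^sub>R (\<Sum>i\<in>I. u i *\<^sub>R \<psi> i)"
      unfolding t(1) by (simp add: scaleR_left_diff_distrib sum_subtractf scaleR_sum_right)
    then have "y = (\<Sum>i\<in>I. ?t i *\<^sub>R \<psi> i)" using u(1) by simp
    also have "\<dots> = (\<Sum>i\<in>I - {k}. ?t i *\<^sub>R \<psi> i)"
      using sum.remove[OF less.prems(1) k(1), of "\<lambda>i. ?t i *\<^sub>R \<psi> i"] tk by simp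
    finally have "y \<in> generated_cone (I - {k}) \<psi>"
      by (rule generated_coneI) (use nonneg in simp)
    moreover have "card (I - {k}) < card I" using less.prems(1) k(1) by (meson card_Diff1_less)
    ultimately obtain J where "J \<subseteq> I - {k}" "independent_family J \<psi>" "y \<in> generated_cone J \<psi>"
      using less.hyps[of "I - {k}"] less.prems(1) by blast
    then show ?thesis by blast
  qed
qed

lemma generated_cone_mono:
  assumes "finite I" "J \<subseteq> I"
  shows "generated_cone J \<psi> \<subseteq> generated_cone I \<psi>"
proof
  fix y assume "y \<in> generated_cone J \<psi>"
  then obtain t where t: "y = (\<Sum>i\<in>J. t i *\<^sub>R \<psi> i)" "\<forall>i\<in>J. 0 \<le> t i"
    unfolding generated_cone_def by blast
  have "y = (\<Sum>i\<in>I. (if i \<in> J then t i else 0) *\<^sub>R \<psi> i)"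
    unfolding t(1) using assms by (intro sum.mono_neutral_cong_left) auto
  then show "y \<in> generated_cone I \<psi>" by (rule generated_coneI) (use t(2) in simp)
qed

lemma generated_cone_cong:
  assumes "\<And>i. i \<in> I \<Longrightarrow> \<psi> i = \<psi>' i"
  shows "generated_cone I \<psi> = generated_cone I \<psi>'"
proof -
  have "(\<Sum>i\<in>I. t i *\<^sub>R \<psi> i) = (\<Sum>i\<in>I. t i *\<^sub>R \<psi>' i)" for t
    using assms by (intro sum.cong) auto
  then show ?thesis unfolding generated_cone_def by simp
qed


section \<open>Bases chosen from a sequence, and their coordinates\<close>

definition indexed_basis :: "nat set \<Rightarrow> (nat \<Rightarrow> 'a::real_vector) \<Rightarrow> bool" where
  "indexed_basis J \<psi> \<longleftrightarrow> inj_on \<psi> J \<and> independent (\<psi> ` J) \<and> span (\<psi> ` J) = UNIV"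

definition coord :: "nat set \<Rightarrow> (nat \<Rightarrow> 'a::real_vector) \<Rightarrow> nat \<Rightarrow> 'a \<Rightarrow> real" where
  "coord J \<psi> j y = representation (\<psi> ` J) y (\<psi> j)"

text \<open>
  Every wall is spanned by all but one vector of a basis taken from the sequence, and every
  simplicial cone met below is completed to a basis, because of this form of basis extension.
\<close>

lemma independent_family_extend:
  fixes \<psi> :: "nat \<Rightarrow> 'a::euclidean_space"
  assumes "finite I" "span (\<psi> ` I) = UNIV" "J \<subseteq> I" "independent_family J \<psi>"
  obtains J' where "J \<subseteq> J'" "J' \<subseteq> I" "indexed_basis J' \<psi>"
proof -
  have J: "inj_on \<psi> J" "independent (\<psi> ` J)"
    using assms(4) independent_family_iff[OF finite_subset[OF assms(3,1)]] by auto
  obtain B where B: "\<psi> ` J \<subseteq> B" "B \<subseteq> \<psi> ` I" "independent B" "\<psi> ` I \<subseteq> span B"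
    by (rule maximal_independent_subset_extend[OF image_mono[OF assms(3)] J(2)])
  have "B - \<psi> ` J \<subseteq> \<psi> ` I" using B(2) by blast
  then obtain U where U: "U \<subseteq> I" "inj_on \<psi> U" "B - \<psi> ` J = \<psi> ` U"
    by (meson subset_image_inj)
  have im: "\<psi> ` (J \<union> U) = B" using B(1) U(3) by blast
  have "\<psi> ` J \<inter> \<psi> ` U = {}" using U(3) by blast
  then have "inj_on \<psi> (J \<union> U)" using J(1) U(2) by (auto simp: inj_on_Un)
  moreover have "span B = UNIV"
    using span_mono[OF B(4)] assms(2) by (simp add: span_span top.extremum_uniqueI)
  ultimately have "indexed_basis (J \<union> U) \<psi>" unfolding indexed_basis_def im using B(3) by simp
  then show ?thesis using that[of "J \<union> U"] U(1) assms(3) by blast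
qed

context
  fixes J :: "nat set" and \<psi> :: "nat \<Rightarrow> 'a::euclidean_space"
  assumes basis: "indexed_basis J \<psi>"
begin

lemma indexed_basis_finite: "finite J" and indexed_basis_card: "card J = DIM('a)"
proof -
  have J: "inj_on \<psi> J" "independent (\<psi> ` J)" "span (\<psi> ` J) = UNIV"
    using basis unfolding indexed_basis_def by auto
  have "finite (\<psi> ` J)" using J(2) by (rule independent_imp_finite)
  then show "finite J" using J(1) by (rule finite_imageD)
  have "card (\<psi> ` J) = DIM('a)"
    using dim_span_eq_card_independent[OF J(2)] J(3) by (simp add: dim_UNIV)
  then show "card J = DIM('a)" using J(1) by (simp add: card_image)
qed

lemma linear_coord: "linear (coord J \<psi> j)"
  using basis unfolding coord_def indexed_basis_def
  by (intro linearI) (simp_all add: representation_add representation_scale)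

lemma sum_coord: "(\<Sum>j\<in>J. coord J \<psi> j y *\<^sub>R \<psi> j) = y"
proof -
  have "(\<Sum>b\<in>\<psi> ` J. representation (\<psi> ` J) y b *\<^sub>R b) = y"
    using basis indexed_basis_finite unfolding indexed_basis_def
    by (intro sum_representation_eq) auto
  then show ?thesis
    using basis unfolding indexed_basis_def coord_def by (simp add: sum.reindex)
qed

lemma coord_basis:
  assumes "i \<in> J" "j \<in> J"
  shows "coord J \<psi> j (\<psi> i) = (if j = i then 1 else 0)"
proof -
  have "representation (\<psi> ` J) (\<psi> i) = (\<lambda>v. if v = \<psi> i then 1 else 0)"
    using basis assms unfolding indexed_basis_def by (intro representation_basis) auto
  then show ?thesis
    using basis assms unfolding indexed_basis_def coord_def by (auto dest: inj_onD)
qed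

lemma coord_sum:
  assumes "K \<subseteq> J" "j \<in> J"
  shows "coord J \<psi> j (\<Sum>i\<in>K. t i *\<^sub>R \<psi> i) = (if j \<in> K then t j else 0)"
proof -
  have "finite K" using assms(1) indexed_basis_finite finite_subset by blast
  moreover have "coord J \<psi> j (\<Sum>i\<in>K. t i *\<^sub>R \<psi> i) = (\<Sum>i\<in>K. t i * (if j = i then 1 else 0))"
    using assms by (simp add: linear_sum[OF linear_coord] linear_scale[OF linear_coord]
        coord_basis subset_iff)
  ultimately show ?thesis by (simp add: if_distrib cong: if_cong)
qed

lemma coord_eq_0_iff:
  assumes "j \<in> J"
  shows "coord J \<psi> j y = 0 \<longleftrightarrow> y \<in> span (\<psi> ` (J - {j}))"
proof
  assume "coord J \<psi> j y = 0"
  then have "y = (\<Sum>i\<in>J - {j}. coord J \<psi> i y *\<^sub>R \<psi> i)"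
    using sum_coord[of y] sum.remove[OF indexed_basis_finite assms, of "\<lambda>i. coord J \<psi> i y *\<^sub>R \<psi> i"]
    by simp
  then show "y \<in> span (\<psi> ` (J - {j}))"
    by (metis (no_types, lifting) imageI span_base span_scale span_sum)
next
  assume "y \<in> span (\<psi> ` (J - {j}))"
  then show "coord J \<psi> j y = 0"
  proof (rule span_induct)
    show "subspace {y. coord J \<psi> j y = 0}"
      using linear_coord[of j]
      by (simp add: subspace_def linear_add linear_scale linear_0)
    show "coord J \<psi> j x = 0" if "x \<in> \<psi> ` (J - {j})" for x
      using that coord_basis assms by (auto split: if_splits)
  qed
qed

lemma generated_cone_iff_coord:
  assumes "K \<subseteq> J"
  shows "y \<in> generated_cone K \<psi> \<longleftrightarrow>
    (\<forall>j\<in>J. 0 \<le> coord J \<psi> j y) \<and> (\<forall>j\<in>J - K. coord J \<psi> j y = 0)"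
proof
  assume "y \<in> generated_cone K \<psi>"
  then obtain t where "y = (\<Sum>i\<in>K. t i *\<^sub>R \<psi> i)" "\<forall>i\<in>K. 0 \<le> t i"
    unfolding generated_cone_def by blast
  then show "(\<forall>j\<in>J. 0 \<le> coord J \<psi> j y) \<and> (\<forall>j\<in>J - K. coord J \<psi> j y = 0)"
    using coord_sum[OF assms] by auto
next
  assume y: "(\<forall>j\<in>J. 0 \<le> coord J \<psi> j y) \<and> (\<forall>j\<in>J - K. coord J \<psi> j y = 0)"
  have "(\<Sum>j\<in>K. coord J \<psi> j y *\<^sub>R \<psi> j) = (\<Sum>j\<in>J. coord J \<psi> j y *\<^sub>R \<psi> j)"
    using y assms indexed_basis_finite by (intro sum.mono_neutral_left) auto
  then have "y = (\<Sum>j\<in>K. coord J \<psi> j y *\<^sub>R \<psi> j)" using sum_coord by simp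
  then show "y \<in> generated_cone K \<psi>"
    by (rule generated_coneI) (use y assms in blast)
qed

end

text \<open>
  Walls are exactly the zero sets of the coordinates with respect to bases taken from the sequence.
  This is how topes and cones are compared: on a tope no such coordinate changes sign.
\<close>

lemma wall_iff_indexed_basis:
  fixes \<psi> :: "nat \<Rightarrow> 'a::euclidean_space"
  assumes "span (\<psi> ` {1..N}) = UNIV"
  shows "wall N \<psi> H \<longleftrightarrow>
    (\<exists>J j. J \<subseteq> {1..N} \<and> indexed_basis J \<psi> \<and> j \<in> J \<and> H = span (\<psi> ` (J - {j})))"
proof
  assume "wall N \<psi> H"
  then obtain B where B: "B \<subseteq> \<psi> ` {1..N}" "independent B" "card B = DIM('a) - 1" "H = span B"
    unfolding wall_def by blast
  obtain K where K: "K \<subseteq> {1..N}" "inj_on \<psi> K" "B = \<psi> ` K"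
    using B(1) by (meson subset_image_inj)
  have finK: "finite K" using K(1) finite_subset by blast
  have cK: "card K = DIM('a) - 1" using B(3) K by (simp add: card_image)
  have "independent_family K \<psi>" using K B(2) finK by (simp add: independent_family_iff)
  then obtain J where J: "K \<subseteq> J" "J \<subseteq> {1..N}" "indexed_basis J \<psi>"
    using independent_family_extend[OF _ assms K(1)] by blast
  have "card (J - K) = 1"
    using indexed_basis_card[OF J(3)] cK J(1) finK DIM_positive[where 'a='a]
    by (simp add: card_Diff_subset)
  then obtain j where "J - K = {j}" by (meson card_1_singletonE)
  then have "j \<in> J" "J - {j} = K" using J(1) by auto
  then show "\<exists>J j. J \<subseteq> {1..N} \<and> indexed_basis J \<psi> \<and> j \<in> J \<and> H = span (\<psi> ` (J - {j}))"
    using J B(4) K(3) by blast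
next
  assume "\<exists>J j. J \<subseteq> {1..N} \<and> indexed_basis J \<psi> \<and> j \<in> J \<and> H = span (\<psi> ` (J - {j}))"
  then obtain J j where J: "J \<subseteq> {1..N}" "indexed_basis J \<psi>" "j \<in> J" "H = span (\<psi> ` (J - {j}))"
    by blast
  have "inj_on \<psi> (J - {j})" "independent (\<psi> ` (J - {j}))"
    using J(2) inj_on_subset[of \<psi> J "J - {j}"] independent_mono[of "\<psi> ` J" "\<psi> ` (J - {j})"]
    unfolding indexed_basis_def by auto
  moreover have "card (J - {j}) = DIM('a) - 1"
    using indexed_basis_card[OF J(2)] indexed_basis_finite[OF J(2)] J(3) by simp
  ultimately show "wall N \<psi> H"
    unfolding wall_def using J(1,4)
    by (intro exI[of _ "\<psi> ` (J - {j})"]) (auto simp: card_image)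
qed


section \<open>Walls and topes\<close>

lemma wall_hyperplane:
  fixes \<psi> :: "nat \<Rightarrow> 'a::euclidean_space"
  assumes "wall N \<psi> H"
  obtains g :: "'a \<Rightarrow> real" where "linear g" "H = {x. g x = 0}"
proof -
  obtain B where B: "independent B" "card B = DIM('a) - 1" "H = span B"
    using assms unfolding wall_def by blast
  have "dim B = DIM('a) - 1" using B(1,2) by (simp add: dim_eq_card_independent)
  then obtain a where "a \<noteq> 0" "span B = {x. a \<bullet> x = 0}" by (rule lowdim_eq_hyperplane)
  moreover have "linear (\<lambda>x. a \<bullet> x)" by (simp add: bounded_linear.linear bounded_linear_inner_right)
  ultimately show ?thesis using that[of "\<lambda>x. a \<bullet> x"] B(3) by simp
qed

text \<open>
  Walls have equal dimension.
\<close>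

lemma wall_subset_imp_eq:
  assumes "wall N \<psi> H" "wall N \<psi> H'" "H \<subseteq> H'"
  shows "H = H'"
proof -
  have "subspace K \<and> dim K = DIM('a) - 1" if "wall N \<psi> K" for K :: "'a set"
    using that unfolding wall_def by (auto simp: dim_eq_card_independent)
  then show ?thesis using assms by (intro subspace_dim_equal) auto
qed

lemma finite_walls: "finite {H. wall N \<psi> H}"
proof (rule finite_subset)
  show "{H. wall N \<psi> H} \<subseteq> span ` Pow (\<psi> ` {1..N})" unfolding wall_def by blast
qed simp

lemma linear_continuous_on_real:
  fixes g :: "'a::euclidean_space \<Rightarrow> real"
  shows "linear g \<Longrightarrow> continuous_on S g"
  by (simp add: linear_continuous_on linear_linear)

lemma linear_nonneg_on_closure:
  fixes g :: "'a::euclidean_space \<Rightarrow> real"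
  assumes "linear g" "\<And>z. z \<in> S \<Longrightarrow> 0 < g z" "x \<in> closure S"
  shows "0 \<le> g x"
proof -
  have "closed {z. 0 \<le> g z}"
    using assms(1) by (intro closed_Collect_le continuous_on_const linear_continuous_on_real)
  moreover have "S \<subseteq> {z. 0 \<le> g z}" using assms(2) by (auto intro: less_imp_le)
  ultimately show ?thesis using assms(3) closure_minimal by blast
qed

text \<open>
  The region where finitely many linear forms are positive is open. Below, the forms are the
  coordinates for a basis, and the region is the interior of a simplicial cone.
\<close>

lemma closure_meets_positive_region:
  fixes g :: "nat \<Rightarrow> 'a::euclidean_space \<Rightarrow> real"
  assumes "finite J" "\<And>j. j \<in> J \<Longrightarrow> linear (g j)" "\<And>j. j \<in> J \<Longrightarrow> 0 < g j x" "x \<in> closure S"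
  obtains z where "z \<in> S" "\<And>j. j \<in> J \<Longrightarrow> 0 < g j z"
proof -
  let ?U = "\<Inter>j\<in>J. {z. 0 < g j z}"
  have "open ?U"
    using assms(1,2)
    by (intro open_INT ballI open_Collect_less continuous_on_const linear_continuous_on_real) auto
  moreover have "x \<in> ?U" using assms(3) by simp
  ultimately have "S \<inter> ?U \<noteq> {}" using assms(4) closure_iff_nhds_not_empty by blast
  then show ?thesis using that by blast
qed

lemma tope_nonempty: "tope N \<psi> \<tau> \<Longrightarrow> \<tau> \<noteq> {}"
  unfolding tope_def by (rule in_components_nonempty)

lemma tope_connected: "tope N \<psi> \<tau> \<Longrightarrow> connected \<tau>"
  unfolding tope_def by (rule in_components_connected)

lemma tope_disjoint_wall: "tope N \<psi> \<tau> \<Longrightarrow> wall N \<psi> H \<Longrightarrow> z \<in> \<tau> \<Longrightarrow> z \<notin> H"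
  unfolding tope_def using in_components_subset by blast

text \<open>
  A tope is connected and the linear form has no zero on it.
\<close>

lemma tope_sign_constant:
  fixes g :: "'a::euclidean_space \<Rightarrow> real"
  assumes "tope N \<psi> \<tau>" "linear g" "wall N \<psi> {x. g x = 0}" "y \<in> \<tau>" "z \<in> \<tau>" "0 < g y"
  shows "0 < g z"
proof (rule ccontr)
  assume "\<not> 0 < g z"
  moreover have "connected (g ` \<tau>)"
    using assms(1,2) by (intro connected_continuous_image linear_continuous_on_real tope_connected)
  ultimately have "0 \<in> g ` \<tau>"
    using assms(4-6) connectedD_interval[of "g ` \<tau>" "g z" "g y" 0] by auto
  then show False using tope_disjoint_wall[OF assms(1,3)] by auto
qed

lemma tope_sign_mult:
  fixes g :: "'a::euclidean_space \<Rightarrow> real"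
  assumes "tope N \<psi> \<tau>" "linear g" "wall N \<psi> {x. g x = 0}" "y \<in> \<tau>" "z \<in> \<tau>"
  shows "0 < g y * g z"
proof (cases "0 < g y")
  case True
  then show ?thesis using tope_sign_constant[OF assms True] by simp
next
  case False
  moreover have "g y \<noteq> 0" "g z \<noteq> 0" using tope_disjoint_wall[OF assms(1,3)] assms(4,5) by auto
  moreover have "\<not> 0 < g z" using tope_sign_constant[OF assms(1-3) assms(5,4)] False by blast
  ultimately show ?thesis by (simp add: mult_neg_neg)
qed

text \<open>
  A point on the same side of every wall as a point of a tope belongs to the tope, since the segment
  between them avoids all walls. The linear form may be chosen separately for each wall, so
  that a given equation of one wall can be used for it.
\<close>

lemma segment_subset_tope:
  fixes \<psi> :: "nat \<Rightarrow> 'a::euclidean_space"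
  assumes \<tau>: "tope N \<psi> \<tau>" "y \<in> \<tau>"
    and sep: "\<And>H. wall N \<psi> H \<Longrightarrow>
      \<exists>g :: 'a \<Rightarrow> real. linear g \<and> H = {x. g x = 0} \<and> 0 < g y * g z"
  shows "closed_segment y z \<subseteq> \<tau>"
proof (rule components_maximal)
  show "\<tau> \<in> components (- \<Union>{H. wall N \<psi> H})" using \<tau>(1) unfolding tope_def .
  show "closed_segment y z \<subseteq> - \<Union>{H. wall N \<psi> H}"
  proof
    fix w assume "w \<in> closed_segment y z"
    then obtain u where u: "w = (1 - u) *\<^sub>R y + u *\<^sub>R z" "0 \<le> u" "u \<le> 1"
      unfolding closed_segment_def by blast
    have "w \<notin> H" if H: "wall N \<psi> H" for H
    proof -
      obtain g :: "'a \<Rightarrow> real" where g: "linear g" "H = {x. g x = 0}" "0 < g y * g z"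
        using sep[OF H] by blast
      have gw: "g w = (1 - u) * g y + u * g z"
        using g(1) unfolding u(1) by (simp only: linear_add linear_scale real_scaleR_def)
      have "g y * g w = (1 - u) * (g y * g y) + u * (g y * g z)"
        unfolding gw by (simp add: algebra_simps)
      moreover have "0 < g y * g y" using g(3) by (auto simp: zero_less_mult_iff)
      then have "0 < (1 - u) * (g y * g y) + u * (g y * g z)"
        using g(3) u(2,3) by (cases "u = 0") (auto intro: add_nonneg_pos)
      ultimately have "g w \<noteq> 0" by auto
      then show ?thesis using g(2) by simp
    qed
    then show "w \<in> - \<Union>{H. wall N \<psi> H}" by blast
  qed
  show "\<tau> \<inter> closed_segment y z \<noteq> {}" using \<tau>(2) by auto
qed (rule connected_segment)

lemma convex_tope:
  fixes \<psi> :: "nat \<Rightarrow> 'a::euclidean_space"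
  assumes "tope N \<psi> \<tau>"
  shows "convex \<tau>"
  unfolding convex_contains_segment
proof (intro ballI segment_subset_tope[OF assms])
  fix y z H assume "y \<in> \<tau>" "z \<in> \<tau>" and H: "wall N \<psi> H"
  moreover obtain g :: "'a \<Rightarrow> real" where "linear g" "H = {x. g x = 0}"
    using wall_hyperplane[OF H] .
  ultimately show "\<exists>g :: 'a \<Rightarrow> real. linear g \<and> H = {x. g x = 0} \<and> 0 < g y * g z"
    using tope_sign_mult[OF assms] by blast
qed

text \<open>
  Topes are invariant under positive scaling. This provides a common point of the closures of any
  two topes.
\<close>

lemma zero_in_closure_tope:
  fixes \<psi> :: "nat \<Rightarrow> 'a::euclidean_space"
  assumes "tope N \<psi> \<tau>"
  shows "0 \<in> closure \<tau>"
proof -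
  obtain y where y: "y \<in> \<tau>" using tope_nonempty[OF assms] by blast
  \<comment> \<open>Scaling by a positive factor changes no sign.\<close>
  have mem: "inverse (real (Suc n)) *\<^sub>R y \<in> \<tau>" for n
  proof -
    have "closed_segment y (inverse (real (Suc n)) *\<^sub>R y) \<subseteq> \<tau>"
    proof (rule segment_subset_tope[OF assms y])
      fix H assume H: "wall N \<psi> H"
      obtain g :: "'a \<Rightarrow> real" where g: "linear g" "H = {x. g x = 0}"
        using wall_hyperplane[OF H] .
      have "0 < inverse (real (Suc n)) * (g y * g y)"
        using tope_sign_mult[OF assms g(1) H[unfolded g(2)] y y] by simp
      then have "0 < g y * g (inverse (real (Suc n)) *\<^sub>R y)"
        using g(1) by (simp add: linear_scale mult_ac)
      then show "\<exists>g :: 'a \<Rightarrow> real. linear g \<and> H = {x. g x = 0} \<and>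
          0 < g y * g (inverse (real (Suc n)) *\<^sub>R y)"
        using g by blast
    qed
    then show ?thesis by auto
  qed
  have "(\<lambda>n. inverse (real (Suc n)) *\<^sub>R y) \<longlonglongrightarrow> 0 *\<^sub>R y"
    by (intro tendsto_intros LIMSEQ_inverse_real_of_nat)
  then show ?thesis
    unfolding closure_sequential using mem
    by (intro exI[of _ "\<lambda>n. inverse (real (Suc n)) *\<^sub>R y"]) simp
qed

text \<open>
  The intersection \<open>E\<close> of the closures is convex and spans \<open>H\<close>, so it is contained in no other wall.
  Take \<open>x\<close> in \<open>E\<close> on as few walls other than \<open>H\<close> as possible. If \<open>x\<close> were on such a wall \<open>K\<close>, then
  moving \<open>x\<close> slightly towards a point of \<open>E\<close> outside \<open>K\<close> would leave \<open>K\<close> and reach no new wall.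
\<close>

lemma common_wall_generic_point:
  fixes \<psi> :: "nat \<Rightarrow> 'a::euclidean_space"
  assumes \<tau>: "tope N \<psi> \<tau>\<^sub>1" "tope N \<psi> \<tau>\<^sub>2" and cw: "common_wall N \<psi> \<tau>\<^sub>1 \<tau>\<^sub>2 H"
  obtains x where "x \<in> closure \<tau>\<^sub>1" "x \<in> closure \<tau>\<^sub>2" "x \<in> H"
    "\<And>H'. wall N \<psi> H' \<Longrightarrow> x \<in> H' \<Longrightarrow> H' = H"
proof -
  define E where "E = closure \<tau>\<^sub>1 \<inter> closure \<tau>\<^sub>2"
  define W where "W = (\<lambda>x. {H'. wall N \<psi> H' \<and> H' \<noteq> H \<and> x \<in> H'})"
  have H: "wall N \<psi> H" "E \<subseteq> H" "span E = H" using cw unfolding common_wall_def E_def by auto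
  have convE: "convex E"
    unfolding E_def using \<tau> by (intro convex_Int convex_closure convex_tope)
  have finW: "finite (W x)" for x
    unfolding W_def by (rule finite_subset[OF _ finite_walls[of N \<psi>]]) blast
  have "0 \<in> E" unfolding E_def using \<tau> zero_in_closure_tope by blast
  then obtain x where x: "x \<in> E" and least: "\<And>z. z \<in> E \<Longrightarrow> card (W x) \<le> card (W z)"
    using ex_has_least_nat[of "\<lambda>z. z \<in> E" 0 "\<lambda>z. card (W z)"] by blast
  have "W x = {}"
  proof (rule ccontr)
    assume "W x \<noteq> {}"
    then obtain K where K: "wall N \<psi> K" "K \<noteq> H" "x \<in> K" unfolding W_def by blast
    have subK: "subspace K" using K(1) unfolding wall_def by auto
    have "\<not> E \<subseteq> K"
      using span_minimal[OF _ subK, of E] wall_subset_imp_eq[OF H(1) K(1)] K(2) H(3) by blast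
    then obtain y where y: "y \<in> E" "y \<notin> K" by blast
    define g where "g = (\<lambda>t::real. x + t *\<^sub>R (y - x))"
    have lim: "(g \<longlongrightarrow> x) (at_right 0)"
    proof -
      have "((\<lambda>t::real. x + t *\<^sub>R (y - x)) \<longlongrightarrow> x + 0 *\<^sub>R (y - x)) (at_right 0)"
        by (intro tendsto_intros)
      then show ?thesis unfolding g_def by simp
    qed
    have "\<forall>\<^sub>F t in at_right 0. g t \<notin> K'" if "K' \<in> {H. wall N \<psi> H} - W x - {H}" for K'
    proof -
      have "closed K'" using that unfolding wall_def by (auto simp: closed_span)
      moreover have "x \<notin> K'" using that unfolding W_def by blast
      ultimately show ?thesis
        using topological_tendstoD[OF lim, of "- K'"] by (simp add: open_Compl)
    qed
    then have "\<forall>\<^sub>F t in at_right 0. \<forall>K' \<in> {H. wall N \<psi> H} - W x - {H}. g t \<notin> K'"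
      by (intro eventually_ball_finite) (auto simp: finite_walls)
    moreover have "\<forall>\<^sub>F t in at_right (0::real). 0 < t \<and> t < 1"
      using eventually_at_right_real[of 0 1] by (simp add: greaterThanLessThan_iff)
    ultimately have "\<forall>\<^sub>F t in at_right (0::real).
        (\<forall>K' \<in> {H. wall N \<psi> H} - W x - {H}. g t \<notin> K') \<and> 0 < t \<and> t < 1"
      by (rule eventually_conj)
    then obtain t where t: "\<forall>K' \<in> {H. wall N \<psi> H} - W x - {H}. g t \<notin> K'" "0 < t" "t < 1"
      using eventually_happens'[OF trivial_limit_at_right_real] by blast
    have gt: "g t = (1 - t) *\<^sub>R x + t *\<^sub>R y" unfolding g_def by (simp add: algebra_simps)
    have "g t \<in> E" unfolding gt using convE x y(1) t(2,3) by (simp add: convexD_alt)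
    have "g t \<notin> K"
    proof
      assume "g t \<in> K"
      then have "t *\<^sub>R (y - x) \<in> K"
        using subspace_diff[OF subK _ K(3), of "g t"] unfolding g_def by simp
      then have "y - x \<in> K" using subspace_scale[OF subK, of "t *\<^sub>R (y - x)" "inverse t"] t(2) by simp
      then show False using subspace_add[OF subK _ K(3), of "y - x"] y(2) by simp
    qed
    then have "K \<in> W x - W (g t)" using K unfolding W_def by blast
    moreover have "W (g t) \<subseteq> W x" using t(1) unfolding W_def by blast
    ultimately have "card (W (g t)) < card (W x)" by (intro psubset_card_mono finW) blast
    then show False using least[OF \<open>g t \<in> E\<close>] by simp
  qed
  then show ?thesis using that[of x] x H(2) unfolding E_def W_def by blast
qed

text \<open>
  For every wall other than \<open>H\<close>, a generic point of \<open>H\<close> shows that both topes are on the same side. If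
  they were on the same side of \<open>H\<close> too, they would be equal; but a tope is not contained in a wall.
\<close>

lemma common_wall_separates:
  fixes f :: "'a::euclidean_space \<Rightarrow> real"
  assumes \<tau>: "tope N \<psi> \<tau>\<^sub>1" "tope N \<psi> \<tau>\<^sub>2" and cw: "common_wall N \<psi> \<tau>\<^sub>1 \<tau>\<^sub>2 {x. f x = 0}"
    and f: "linear f" and pos: "\<And>z. z \<in> \<tau>\<^sub>1 \<Longrightarrow> 0 < f z" and z: "z \<in> \<tau>\<^sub>2"
  shows "f z < 0"
proof (rule ccontr)
  assume neg: "\<not> f z < 0"
  have H: "wall N \<psi> {x. f x = 0}" using cw unfolding common_wall_def by blast
  have fz: "0 < f z" using tope_disjoint_wall[OF \<tau>(2) H z] neg by auto
  obtain x where x: "x \<in> closure \<tau>\<^sub>1" "x \<in> closure \<tau>\<^sub>2"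
    "\<And>H'. wall N \<psi> H' \<Longrightarrow> x \<in> H' \<Longrightarrow> H' = {x. f x = 0}"
    using common_wall_generic_point[OF \<tau> cw] by blast
  obtain y where y: "y \<in> \<tau>\<^sub>1" using tope_nonempty[OF \<tau>(1)] by blast
  have "closed_segment y z \<subseteq> \<tau>\<^sub>1"
  proof (rule segment_subset_tope[OF \<tau>(1) y])
    fix H' assume H': "wall N \<psi> H'"
    show "\<exists>g :: 'a \<Rightarrow> real. linear g \<and> H' = {x. g x = 0} \<and> 0 < g y * g z"
    proof (cases "H' = {x. f x = 0}")
      case True
      then show ?thesis using f pos[OF y] fz by (intro exI[of _ f]) simp
    next
      case False
      obtain g :: "'a \<Rightarrow> real" where g: "linear g" "H' = {x. g x = 0}" using wall_hyperplane[OF H'] .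
      have gx: "g x \<noteq> 0" using x(3)[OF H'] False g(2) by blast
      have W: "wall N \<psi> {x. g x = 0}" using H' g(2) by simp
      have same_sign: "0 < g x * g w" if w: "w \<in> \<tau>" "tope N \<psi> \<tau>" "x \<in> closure \<tau>" for w \<tau>
      proof -
        have "linear (\<lambda>v. g w * g v)"
          using g(1) by (simp add: linear_compose_scale_right[of g "g w", simplified])
        then have "0 \<le> g w * g x"
          using linear_nonneg_on_closure[of "\<lambda>v. g w * g v" \<tau> x] tope_sign_mult[OF w(2) g(1) W w(1)] w(3)
          by blast
        moreover have "g w \<noteq> 0" using tope_disjoint_wall[OF w(2) W w(1)] by simp
        ultimately show ?thesis using gx by (simp add: mult.commute order_less_le)
      qed
      have "0 < g x * g y" "0 < g x * g z"
        using same_sign[OF y \<tau>(1) x(1)] same_sign[OF z \<tau>(2) x(2)] by auto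
      then have "0 < g y * g z" by (auto simp: zero_less_mult_iff)
      then show ?thesis using g by blast
    qed
  qed
  then have "z \<in> \<tau>\<^sub>1" by auto
  then have "\<tau>\<^sub>1 = \<tau>\<^sub>2" using z \<tau> components_eq unfolding tope_def by blast
  then have "z \<in> {x. f x = 0}"
    using cw z closure_subset unfolding common_wall_def by blast
  then show False using fz by simp
qed


section \<open>Topes and cones\<close>

text \<open>
  By Caratheodory's theorem, \<open>y\<close> is in the cone of an independent subfamily \<open>K\<close> of \<open>I\<close>. Complete \<open>K\<close>
  to a basis. The coordinates of \<open>y\<close> are nonnegative, and they are not zero because \<open>y\<close> is on no wall.
  So \<open>K\<close> was a basis, and its coordinates keep their sign on the whole tope.
\<close>

lemma simplicial_cone_containing_tope:
  fixes \<psi> :: "nat \<Rightarrow> 'a::euclidean_space"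
  assumes span: "span (\<psi> ` {1..N}) = UNIV" and \<tau>: "tope N \<psi> \<tau>"
    and I: "I \<subseteq> {1..N}" and y: "y \<in> \<tau>" "y \<in> generated_cone I \<psi>"
  obtains J where "J \<subseteq> I" "indexed_basis J \<psi>" "\<And>z j. z \<in> \<tau> \<Longrightarrow> j \<in> J \<Longrightarrow> 0 < coord J \<psi> j z"
proof -
  have "finite I" using I finite_subset by blast
  then obtain K where K: "K \<subseteq> I" "independent_family K \<psi>" "y \<in> generated_cone K \<psi>"
    using cone_caratheodory y(2) by blast
  obtain J where J: "K \<subseteq> J" "J \<subseteq> {1..N}" "indexed_basis J \<psi>"
    using independent_family_extend[OF _ span _ K(2)] K(1) I by blast
  have wall: "wall N \<psi> {z. coord J \<psi> j z = 0}" if "j \<in> J" for j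
    unfolding wall_iff_indexed_basis[OF span] coord_eq_0_iff[OF J(3) that] using J that by auto
  have ne0: "coord J \<psi> j y \<noteq> 0" if "j \<in> J" for j
    using tope_disjoint_wall[OF \<tau> wall[OF that] y(1)] by simp
  have y_coord: "\<forall>j\<in>J. 0 \<le> coord J \<psi> j y" "\<forall>j\<in>J - K. coord J \<psi> j y = 0"
    using K(3) generated_cone_iff_coord[OF J(3,1)] by auto
  have "J = K" using ne0 y_coord(2) J(1) by blast
  moreover have "0 < coord J \<psi> j z" if "z \<in> \<tau>" "j \<in> J" for z j
  proof -
    have "0 < coord J \<psi> j y" using ne0 y_coord(1) that(2) by (simp add: order_less_le)
    then show ?thesis
      using tope_sign_constant[OF \<tau> linear_coord[OF J(3)] wall y(1) that(1)] that(2) by blast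
  qed
  ultimately show ?thesis using that[of J] K(1) J(3) by blast
qed

lemma tope_subset_cone:
  fixes \<psi> :: "nat \<Rightarrow> 'a::euclidean_space"
  assumes "span (\<psi> ` {1..N}) = UNIV" "tope N \<psi> \<tau>" "I \<subseteq> {1..N}" "y \<in> \<tau>" "y \<in> generated_cone I \<psi>"
  shows "\<tau> \<subseteq> generated_cone I \<psi>"
proof
  fix z assume z: "z \<in> \<tau>"
  obtain J where J: "J \<subseteq> I" "indexed_basis J \<psi>" "\<And>z j. z \<in> \<tau> \<Longrightarrow> j \<in> J \<Longrightarrow> 0 < coord J \<psi> j z"
    by (rule simplicial_cone_containing_tope[OF assms]) blast
  have "z \<in> generated_cone J \<psi>"
    using J(3)[OF z] generated_cone_iff_coord[OF J(2) subset_refl] by (simp add: less_imp_le)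
  then show "z \<in> generated_cone I \<psi>"
    using generated_cone_mono[OF _ J(1)] assms(3) finite_subset by blast
qed

lemma tope_subset_cone_imp_generating:
  fixes \<psi> :: "nat \<Rightarrow> 'a::euclidean_space"
  assumes span: "span (\<psi> ` {1..N}) = UNIV" and \<tau>: "tope N \<psi> \<tau>"
    and I: "I \<subseteq> {1..N}" "\<tau> \<subseteq> generated_cone I \<psi>"
  shows "span (\<psi> ` I) = UNIV" and "DIM('a) \<le> card I"
proof -
  obtain y where y: "y \<in> \<tau>" using tope_nonempty[OF \<tau>] by blast
  then have "y \<in> generated_cone I \<psi>" using I(2) by blast
  then obtain J where J: "J \<subseteq> I" "indexed_basis J \<psi>"
    by (rule simplicial_cone_containing_tope[OF span \<tau> I(1) y]) blast
  show "span (\<psi> ` I) = UNIV"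
    using span_mono[OF image_mono[OF J(1)], of \<psi>] J(2) unfolding indexed_basis_def by blast
  show "DIM('a) \<le> card I"
    using indexed_basis_card[OF J(2)] card_mono[OF finite_subset[OF I(1)] J(1)] by simp
qed

text \<open>
  Take a simplicial cone \<open>c(J)\<close> with \<open>J \<subseteq> I\<close> that contains \<open>\<tau>\<close> in its interior. If \<open>x\<close> is on a facet
  of it, the facet spans a wall through \<open>x\<close>, which must be \<open>{f = 0}\<close>; then \<open>x\<close> is in the cone of the
  vectors of \<open>I\<close> in this wall, contrary to the assumption. So \<open>x\<close> is interior to \<open>c(J)\<close>, and \<open>\<tau>'\<close>, which
  comes arbitrarily close to \<open>x\<close>, meets \<open>c(J)\<close>.
\<close>

lemma tope_subset_cone_across_wall:
  fixes \<psi> :: "nat \<Rightarrow> 'a::euclidean_space" and f :: "'a \<Rightarrow> real"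
  assumes span: "span (\<psi> ` {1..N}) = UNIV"
    and \<tau>: "tope N \<psi> \<tau>" "tope N \<psi> \<tau>'" and x: "x \<in> closure \<tau>" "x \<in> closure \<tau>'"
    and only: "\<And>H. wall N \<psi> H \<Longrightarrow> x \<in> H \<Longrightarrow> H = {z. f z = 0}"
    and I: "I \<subseteq> {1..N}" "\<tau> \<subseteq> generated_cone I \<psi>"
    and notin: "x \<notin> generated_cone {i \<in> I. f (\<psi> i) = 0} \<psi>"
  shows "\<tau>' \<subseteq> generated_cone I \<psi>"
proof -
  have finI: "finite I" using I(1) finite_subset by blast
  obtain y where y: "y \<in> \<tau>" using tope_nonempty[OF \<tau>(1)] by blast
  then have "y \<in> generated_cone I \<psi>" using I(2) by blast
  then obtain J where J: "J \<subseteq> I" "indexed_basis J \<psi>"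
    "\<And>z j. z \<in> \<tau> \<Longrightarrow> j \<in> J \<Longrightarrow> 0 < coord J \<psi> j z"
    by (rule simplicial_cone_containing_tope[OF span \<tau>(1) I(1) y]) blast
  have nonneg: "0 \<le> coord J \<psi> j x" if "j \<in> J" for j
    using linear_nonneg_on_closure[OF linear_coord[OF J(2)] _ x(1)] J(3) that by blast
  have pos: "0 < coord J \<psi> j x" if j: "j \<in> J" for j
  proof (rule ccontr)
    assume "\<not> 0 < coord J \<psi> j x"
    then have 0: "coord J \<psi> j x = 0" using nonneg[OF j] by simp
    let ?H = "span (\<psi> ` (J - {j}))"
    have "wall N \<psi> ?H"
      unfolding wall_iff_indexed_basis[OF span] using J(1,2) I(1) j by blast
    moreover have "x \<in> ?H" using 0 coord_eq_0_iff[OF J(2) j] by simp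
    ultimately have H: "?H = {z. f z = 0}" by (rule only)
    have sub: "J - {j} \<subseteq> {i \<in> I. f (\<psi> i) = 0}"
    proof
      fix i assume i: "i \<in> J - {j}"
      then have "\<psi> i \<in> ?H" by (blast intro: span_base)
      then show "i \<in> {i \<in> I. f (\<psi> i) = 0}" using i J(1) H by blast
    qed
    have "x \<in> generated_cone (J - {j}) \<psi>"
      using generated_cone_iff_coord[OF J(2), of "J - {j}"] nonneg 0 j by auto
    then have "x \<in> generated_cone {i \<in> I. f (\<psi> i) = 0} \<psi>"
      using generated_cone_mono[OF _ sub] finI by auto
    then show False using notin by simp
  qed
  obtain z where z: "z \<in> \<tau>'" "\<And>j. j \<in> J \<Longrightarrow> 0 < coord J \<psi> j z"
  proof (rule closure_meets_positive_region[OF indexed_basis_finite[OF J(2)] linear_coord[OF J(2)] _ x(2)])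
    show "0 < coord J \<psi> j x" if "j \<in> J" for j using pos that by blast
  qed blast
  have "z \<in> generated_cone J \<psi>"
    using z(2) generated_cone_iff_coord[OF J(2) subset_refl] by (simp add: less_imp_le)
  then have "z \<in> generated_cone I \<psi>" using generated_cone_mono[OF finI J(1)] by blast
  then show ?thesis by (rule tope_subset_cone[OF span \<tau>(2) I(1) z(1)])
qed

lemma cone_in_half_space:
  fixes f :: "'a::real_vector \<Rightarrow> real"
  assumes "linear f" "\<And>i. i \<in> I \<Longrightarrow> f (\<psi> i) \<le> 0" "y \<in> generated_cone I \<psi>"
  shows "f y \<le> 0"
proof -
  obtain t where t: "y = (\<Sum>i\<in>I. t i *\<^sub>R \<psi> i)" "\<forall>i\<in>I. 0 \<le> t i"
    using assms(3) unfolding generated_cone_def by blast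
  have "f y = (\<Sum>i\<in>I. t i * f (\<psi> i))"
    unfolding t(1) by (simp add: linear_sum[OF assms(1)] linear_scale[OF assms(1)])
  also have "\<dots> \<le> 0" using t(2) assms(2) by (intro sum_nonpos mult_nonneg_nonpos) auto
  finally show ?thesis .
qed

text \<open>
  If \<open>f\<close> is nowhere positive on \<open>I\<close>, the cone lies in the half-space opposite to \<open>\<tau>\<close>. Otherwise take
  \<open>a \<in> I\<close> with \<open>f\<close> positive and an independent subfamily \<open>K\<close> of \<open>I\<close> in the wall with \<open>x \<in> c(K)\<close>. Since
  \<open>x\<close> is on no other wall, \<open>K\<close> and \<open>a\<close> form a basis in which all coordinates of \<open>x\<close> except that of \<open>a\<close>
  are positive. At points of \<open>\<tau>\<close> near \<open>x\<close> these stay positive, and the coordinate of \<open>a\<close> is positive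
  because \<open>f\<close> is.
\<close>

lemma tope_subset_cone_iff_at_wall:
  fixes \<psi> :: "nat \<Rightarrow> 'a::euclidean_space" and f :: "'a \<Rightarrow> real"
  assumes span: "span (\<psi> ` {1..N}) = UNIV"
    and \<tau>: "tope N \<psi> \<tau>" "x \<in> closure \<tau>" and f: "linear f" "\<And>z. z \<in> \<tau> \<Longrightarrow> 0 < f z"
    and only: "\<And>H. wall N \<psi> H \<Longrightarrow> x \<in> H \<Longrightarrow> H = {z. f z = 0}"
    and I: "I \<subseteq> {1..N}" and x: "x \<in> generated_cone {i \<in> I. f (\<psi> i) = 0} \<psi>"
  shows "\<tau> \<subseteq> generated_cone I \<psi> \<longleftrightarrow> (\<exists>i\<in>I. 0 < f (\<psi> i))"
proof
  assume sub: "\<tau> \<subseteq> generated_cone I \<psi>"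
  obtain y where y: "y \<in> \<tau>" using tope_nonempty[OF \<tau>(1)] by blast
  show "\<exists>i\<in>I. 0 < f (\<psi> i)"
    using cone_in_half_space[OF f(1), of I \<psi> y] sub y f(2)[OF y] by force
next
  assume "\<exists>i\<in>I. 0 < f (\<psi> i)"
  then obtain a where a: "a \<in> I" "0 < f (\<psi> a)" by blast
  have finI: "finite I" using I finite_subset by blast
  then obtain K where K: "K \<subseteq> {i \<in> I. f (\<psi> i) = 0}" "independent_family K \<psi>" "x \<in> generated_cone K \<psi>"
    using cone_caratheodory[OF _ x] by auto
  have finK: "finite K" by (rule finite_subset[OF K(1)]) (simp add: finI)
  have fK: "f (\<psi> i) = 0" if "i \<in> K" for i using K(1) that by blast
  have aK: "a \<notin> K" using fK[of a] a(2) by auto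
  have "independent_family (insert a K) \<psi>"
    unfolding independent_family_def
  proof (intro allI impI)
    fix u assume u: "(\<Sum>j\<in>insert a K. u j *\<^sub>R \<psi> j) = 0"
    have "f (\<Sum>j\<in>insert a K. u j *\<^sub>R \<psi> j) = u a * f (\<psi> a)"
      using finK aK fK by (simp add: linear_add[OF f(1)] linear_sum[OF f(1)] linear_scale[OF f(1)])
    then have ua: "u a = 0" using u a(2) linear_0[OF f(1)] by simp
    then have "(\<Sum>j\<in>K. u j *\<^sub>R \<psi> j) = 0" using u finK aK by simp
    then have "\<forall>j\<in>K. u j = 0" using K(2) unfolding independent_family_def by blast
    then show "\<forall>j\<in>insert a K. u j = 0" using ua by simp
  qed
  moreover have "insert a K \<subseteq> {1..N}" using K(1) a(1) I by blast
  ultimately obtain J where J: "insert a K \<subseteq> J" "J \<subseteq> {1..N}" "indexed_basis J \<psi>"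
    using independent_family_extend[OF _ span] by blast
  have x_coord: "\<forall>j\<in>J. 0 \<le> coord J \<psi> j x" "\<forall>j\<in>J - K. coord J \<psi> j x = 0"
    using K(3) generated_cone_iff_coord[OF J(3), of K] J(1) by auto
  \<comment> \<open>The zero set of a coordinate other than that of \<open>a\<close> contains the vector of \<open>a\<close>, so it is not \<open>{f = 0}\<close>.\<close>
  have pos: "0 < coord J \<psi> j x" if j: "j \<in> J" "j \<noteq> a" for j
  proof (rule ccontr)
    assume "\<not> 0 < coord J \<psi> j x"
    then have "coord J \<psi> j x = 0" using x_coord(1) j(1) by force
    then have "x \<in> span (\<psi> ` (J - {j}))" using coord_eq_0_iff[OF J(3) j(1)] by simp
    moreover have "wall N \<psi> (span (\<psi> ` (J - {j})))"
      unfolding wall_iff_indexed_basis[OF span] using J(2,3) j(1) by blast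
    ultimately have "span (\<psi> ` (J - {j})) = {z. f z = 0}" using only by blast
    moreover have "\<psi> a \<in> span (\<psi> ` (J - {j}))" using J(1) j(2) by (blast intro: span_base)
    ultimately show False using a(2) by simp
  qed
  have "J - {a} \<subseteq> K" using pos x_coord(2) by force
  then have J_eq: "J = insert a K" using J(1) by blast
  obtain z where z: "z \<in> \<tau>" "\<And>j. j \<in> K \<Longrightarrow> 0 < coord J \<psi> j z"
  proof (rule closure_meets_positive_region[OF finK linear_coord[OF J(3)] _ \<tau>(2)])
    show "0 < coord J \<psi> j x" if "j \<in> K" for j using pos that aK J(1) by blast
  qed blast
  have "f z = f (\<Sum>j\<in>insert a K. coord J \<psi> j z *\<^sub>R \<psi> j)"
    using sum_coord[OF J(3), of z] J_eq by simp
  also have "\<dots> = coord J \<psi> a z * f (\<psi> a)"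
    using finK aK fK by (simp add: linear_add[OF f(1)] linear_sum[OF f(1)] linear_scale[OF f(1)])
  finally have "0 < coord J \<psi> a z" using f(2)[OF z(1)] a(2) by (simp add: zero_less_mult_iff)
  then have "z \<in> generated_cone J \<psi>"
    using z(2) J_eq generated_cone_iff_coord[OF J(3) subset_refl] by (auto intro: less_imp_le)
  moreover have "J \<subseteq> I" using J_eq K(1) a(1) by blast
  ultimately have "z \<in> generated_cone I \<psi>" using generated_cone_mono[OF finI] by blast
  then show "\<tau> \<subseteq> generated_cone I \<psi>" by (rule tope_subset_cone[OF span \<tau>(1) I z(1)])
qed


section \<open>The jump of the polynomial across a wall\<close>

lemma sum_Pow_Un_disjoint:
  assumes "finite S" "finite T" "S \<inter> T = {}"
  shows "(\<Sum>I\<in>Pow (S \<union> T). h (I \<inter> S) (I \<inter> T)) = (\<Sum>I\<in>Pow S. \<Sum>J\<in>Pow T. h I J)"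
proof -
  have "(\<Sum>I\<in>Pow (S \<union> T). h (I \<inter> S) (I \<inter> T)) = (\<Sum>(I, J)\<in>Pow S \<times> Pow T. h I J)"
    by (rule sum.reindex_bij_witness[of _ "\<lambda>(I, J). I \<union> J" "\<lambda>I. (I \<inter> S, I \<inter> T)"])
       (use assms(3) in auto)
  then show ?thesis by (simp add: sum.cartesian_product)
qed

text \<open>
  The sign is distributed over the factors, so that a term is multiplicative along a partition of the
  index set.
\<close>

definition signed_term :: "nat set \<Rightarrow> nat set \<Rightarrow> pq_poly" where
  "signed_term S I = (\<Prod>i\<in>I. - (p i + q i)) * (\<Prod>i\<in>S - I. p i)"

lemma signed_term_empty: "signed_term S {} = (\<Prod>i\<in>S. p i)"
  by (simp add: signed_term_def)

lemma sum_signed_term: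
  assumes "finite S"
  shows "(\<Sum>I\<in>Pow S. signed_term S I) = (\<Prod>i\<in>S. - q i)"
proof -
  have "(\<Prod>i\<in>S. - (p i + q i) + p i) = (\<Sum>I\<in>Pow S. signed_term S I)"
    unfolding signed_term_def by (rule prod_add[OF assms])
  then show ?thesis by simp
qed

lemma signed_term_Un:
  assumes "finite S" "finite T" "S \<inter> T = {}" "I \<subseteq> S \<union> T"
  shows "signed_term (S \<union> T) I = signed_term S (I \<inter> S) * signed_term T (I \<inter> T)"
proof -
  have I: "I = (I \<inter> S) \<union> (I \<inter> T)" and c: "S \<union> T - I = (S - I \<inter> S) \<union> (T - I \<inter> T)"
    using assms(3,4) by auto
  have "(\<Prod>i\<in>I. - (p i + q i)) = (\<Prod>i\<in>I \<inter> S. - (p i + q i)) * (\<Prod>i\<in>I \<inter> T. - (p i + q i))"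
    by (subst I, rule prod.union_disjoint) (use assms in auto)
  moreover have "(\<Prod>i\<in>S \<union> T - I. p i) = (\<Prod>i\<in>S - I \<inter> S. p i) * (\<Prod>i\<in>T - I \<inter> T. p i)"
    unfolding c by (rule prod.union_disjoint) (use assms in auto)
  ultimately show ?thesis unfolding signed_term_def by (simp add: mult_ac)
qed

text \<open>
  If the cone of \<open>I\<close> contains a tope, then \<open>I\<close> generates the space and has at least \<open>d\<close> elements. So
  the spanning condition is implied, and the sign \<open>(-1)\<^bsup>|I| - d\<^esup>\<close> splits into two factors.
\<close>

lemma BG_poly_eq_sum_signed_term:
  fixes \<psi> :: "nat \<Rightarrow> 'a::euclidean_space"
  assumes "span (\<psi> ` {1..N}) = UNIV" "tope N \<psi> \<tau>"
  shows "BG_poly N \<psi> \<tau> =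
    (-1) ^ DIM('a) * (\<Sum>I\<in>Pow {1..N}. of_bool (\<tau> \<subseteq> generated_cone I \<psi>) * signed_term {1..N} I)"
proof -
  have G: "generating_sets N \<psi> \<tau> = {I \<in> Pow {1..N}. \<tau> \<subseteq> generated_cone I \<psi>}"
    unfolding generating_sets_def using tope_subset_cone_imp_generating(1)[OF assms] by auto
  have summand: "(-1) ^ (card I - DIM('a)) * (\<Prod>i\<in>{1..N} - I. p i) * (\<Prod>i\<in>I. p i + q i) =
      (-1) ^ DIM('a) * signed_term {1..N} I" if "I \<in> generating_sets N \<psi> \<tau>" for I
  proof -
    have "DIM('a) \<le> card I"
      using tope_subset_cone_imp_generating(2)[OF assms] that unfolding G by blast
    then have "(-1) ^ (card I - DIM('a)) = ((-1) ^ DIM('a) * (-1) ^ card I :: pq_poly)"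
      by (metis (no_types, lifting) le_add_diff_inverse minus_one_power_iff mult.assoc
          mult_minus1 mult_minus_left power_add mult_1 minus_minus)
    then show ?thesis unfolding signed_term_def prod_uminus by (simp add: mult_ac)
  qed
  have "BG_poly N \<psi> \<tau> = (\<Sum>I\<in>generating_sets N \<psi> \<tau>. (-1) ^ DIM('a) * signed_term {1..N} I)"
    unfolding BG_poly_def by (rule sum.cong[OF refl summand])
  also have "\<dots> = (\<Sum>I\<in>Pow {1..N}. of_bool (\<tau> \<subseteq> generated_cone I \<psi>) * ((-1) ^ DIM('a) * signed_term {1..N} I))"
    unfolding G by (rule sum.mono_neutral_cong_left) auto
  finally show ?thesis unfolding sum_distrib_left by (simp only: mult.left_commute)
qed

text \<open>
  The contribution \<open>Z\<close> of the vectors in the wall to the jump.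
\<close>

definition wall_sum :: "nat set \<Rightarrow> (nat \<Rightarrow> 'a::real_vector) \<Rightarrow> 'a \<Rightarrow> pq_poly" where
  "wall_sum K \<psi> x = (\<Sum>I\<in>Pow K. of_bool (x \<in> generated_cone I \<psi>) * signed_term K I)"

text \<open>
  Both topes satisfy the criterion at \<open>x\<close>, the second one with \<open>-f\<close> in place of \<open>f\<close>. The difference of
  \<open>[I \<inter> A \<noteq> \<emptyset>]\<close> and \<open>[I \<inter> C \<noteq> \<emptyset>]\<close> is written with the complementary conditions, because summing over
  all \<open>I\<close> disjoint from \<open>C\<close> is easier than over all that meet \<open>C\<close>.
\<close>

lemma indicator_jump:
  fixes \<psi> :: "nat \<Rightarrow> 'a::euclidean_space" and f :: "'a \<Rightarrow> real"
  assumes span: "span (\<psi> ` {1..N}) = UNIV"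
    and \<tau>: "tope N \<psi> \<tau>\<^sub>1" "tope N \<psi> \<tau>\<^sub>2" and x: "x \<in> closure \<tau>\<^sub>1" "x \<in> closure \<tau>\<^sub>2"
    and only: "\<And>H. wall N \<psi> H \<Longrightarrow> x \<in> H \<Longrightarrow> H = {z. f z = 0}"
    and f: "linear f" "\<And>z. z \<in> \<tau>\<^sub>1 \<Longrightarrow> 0 < f z" "\<And>z. z \<in> \<tau>\<^sub>2 \<Longrightarrow> f z < 0"
    and I: "I \<subseteq> {1..N}"
  shows "of_bool (\<tau>\<^sub>1 \<subseteq> generated_cone I \<psi>) - of_bool (\<tau>\<^sub>2 \<subseteq> generated_cone I \<psi>) =
    of_bool (x \<in> generated_cone {i \<in> I. f (\<psi> i) = 0} \<psi>) *
      (of_bool (\<forall>i\<in>I. \<not> f (\<psi> i) < 0) - of_bool (\<forall>i\<in>I. \<not> 0 < f (\<psi> i)) :: 'b::comm_ring_1)"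
proof (cases "x \<in> generated_cone {i \<in> I. f (\<psi> i) = 0} \<psi>")
  case True
  have "\<tau>\<^sub>1 \<subseteq> generated_cone I \<psi> \<longleftrightarrow> (\<exists>i\<in>I. 0 < f (\<psi> i))"
    using tope_subset_cone_iff_at_wall[OF span \<tau>(1) x(1) f(1,2) only I True] .
  moreover have "\<tau>\<^sub>2 \<subseteq> generated_cone I \<psi> \<longleftrightarrow> (\<exists>i\<in>I. 0 < - f (\<psi> i))"
    by (rule tope_subset_cone_iff_at_wall[OF span \<tau>(2) x(2) linear_compose_neg[OF f(1)]])
       (use f(3) only I True in auto)
  ultimately show ?thesis using True by auto
next
  case False
  have "\<tau>\<^sub>1 \<subseteq> generated_cone I \<psi> \<longleftrightarrow> \<tau>\<^sub>2 \<subseteq> generated_cone I \<psi>"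
    using tope_subset_cone_across_wall[OF span \<tau> x only I _ False]
      tope_subset_cone_across_wall[OF span \<tau>(2,1) x(2,1) only I _ False] by blast
  then show ?thesis using False by simp
qed

lemma BG_poly_jump:
  fixes \<psi> :: "nat \<Rightarrow> 'a::euclidean_space" and f :: "'a \<Rightarrow> real"
  assumes span: "span (\<psi> ` {1..N}) = UNIV"
    and \<tau>: "tope N \<psi> \<tau>\<^sub>1" "tope N \<psi> \<tau>\<^sub>2" and x: "x \<in> closure \<tau>\<^sub>1" "x \<in> closure \<tau>\<^sub>2"
    and only: "\<And>H. wall N \<psi> H \<Longrightarrow> x \<in> H \<Longrightarrow> H = {z. f z = 0}"
    and f: "linear f" "\<And>z. z \<in> \<tau>\<^sub>1 \<Longrightarrow> 0 < f z" "\<And>z. z \<in> \<tau>\<^sub>2 \<Longrightarrow> f z < 0"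
    and K: "K = {i \<in> {1..N}. f (\<psi> i) = 0}"
    and A: "A = {i \<in> {1..N}. 0 < f (\<psi> i)}"
    and C: "C = {i \<in> {1..N}. f (\<psi> i) < 0}"
  shows "BG_poly N \<psi> \<tau>\<^sub>1 - BG_poly N \<psi> \<tau>\<^sub>2 = (-1) ^ DIM('a) * wall_sum K \<psi> x *
    ((\<Prod>i\<in>A. - q i) * (\<Prod>i\<in>C. p i) - (\<Prod>i\<in>A. p i) * (\<Prod>i\<in>C. - q i))"
proof -
  have fin: "finite K" "finite A" "finite C" unfolding K A C by auto
  have disj: "A \<inter> C = {}" "K \<inter> (A \<union> C) = {}" unfolding K A C by auto
  have N: "{1..N} = K \<union> (A \<union> C)" unfolding K A C by auto
  define jump :: "nat set \<Rightarrow> nat set \<Rightarrow> pq_poly"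
    where "jump = (\<lambda>I J. (of_bool (J = {}) - of_bool (I = {})) * (signed_term A I * signed_term C J))"
  define h where "h = (\<lambda>I L. of_bool (x \<in> generated_cone I \<psi>) * signed_term K I * jump (L \<inter> A) (L \<inter> C))"
  have summand: "(of_bool (\<tau>\<^sub>1 \<subseteq> generated_cone I \<psi>) - of_bool (\<tau>\<^sub>2 \<subseteq> generated_cone I \<psi>)) *
      signed_term {1..N} I = h (I \<inter> K) (I \<inter> (A \<union> C))" if I: "I \<in> Pow {1..N}" for I
  proof -
    have sets: "{i \<in> I. f (\<psi> i) = 0} = I \<inter> K" "(\<forall>i\<in>I. \<not> f (\<psi> i) < 0) \<longleftrightarrow> I \<inter> C = {}"
      "(\<forall>i\<in>I. \<not> 0 < f (\<psi> i)) \<longleftrightarrow> I \<inter> A = {}" "I \<inter> (A \<union> C) \<inter> A = I \<inter> A" "I \<inter> (A \<union> C) \<inter> C = I \<inter> C"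
      using I unfolding K A C by blast+
    have "signed_term {1..N} I = signed_term K (I \<inter> K) * signed_term (A \<union> C) (I \<inter> (A \<union> C))"
      unfolding N using fin disj I N by (intro signed_term_Un) auto
    moreover have "signed_term (A \<union> C) (I \<inter> (A \<union> C)) = signed_term A (I \<inter> A) * signed_term C (I \<inter> C)"
      using signed_term_Un[OF fin(2,3) disj(1), of "I \<inter> (A \<union> C)"] unfolding sets by blast
    moreover have "of_bool (\<tau>\<^sub>1 \<subseteq> generated_cone I \<psi>) - of_bool (\<tau>\<^sub>2 \<subseteq> generated_cone I \<psi>) =
        of_bool (x \<in> generated_cone (I \<inter> K) \<psi>) * (of_bool (I \<inter> C = {}) - of_bool (I \<inter> A = {}) :: pq_poly)"
      using indicator_jump[OF span \<tau> x only f, of I, where 'b = pq_poly] I unfolding sets by blast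
    ultimately show ?thesis unfolding h_def jump_def sets by (simp only: mult_ac)
  qed
  have "BG_poly N \<psi> \<tau>\<^sub>1 - BG_poly N \<psi> \<tau>\<^sub>2 = (-1) ^ DIM('a) *
      (\<Sum>I\<in>Pow {1..N}. (of_bool (\<tau>\<^sub>1 \<subseteq> generated_cone I \<psi>) - of_bool (\<tau>\<^sub>2 \<subseteq> generated_cone I \<psi>)) *
        signed_term {1..N} I)"
    unfolding BG_poly_eq_sum_signed_term[OF span \<tau>(1)] BG_poly_eq_sum_signed_term[OF span \<tau>(2)]
    by (simp only: right_diff_distrib left_diff_distrib sum_subtractf)
  also have "(\<Sum>I\<in>Pow {1..N}. (of_bool (\<tau>\<^sub>1 \<subseteq> generated_cone I \<psi>) - of_bool (\<tau>\<^sub>2 \<subseteq> generated_cone I \<psi>)) *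
        signed_term {1..N} I) = (\<Sum>I\<in>Pow (K \<union> (A \<union> C)). h (I \<inter> K) (I \<inter> (A \<union> C)))"
    by (rule sum.cong) (use N summand in auto)
  also have "\<dots> = (\<Sum>I\<in>Pow K. \<Sum>L\<in>Pow (A \<union> C). h I L)"
    using fin disj by (intro sum_Pow_Un_disjoint) auto
  also have "\<dots> = wall_sum K \<psi> x * (\<Sum>L\<in>Pow (A \<union> C). jump (L \<inter> A) (L \<inter> C))"
    unfolding wall_sum_def h_def by (rule sum_product[symmetric])
  also have "(\<Sum>L\<in>Pow (A \<union> C). jump (L \<inter> A) (L \<inter> C)) = (\<Sum>I\<in>Pow A. \<Sum>J\<in>Pow C. jump I J)"
    using fin disj by (intro sum_Pow_Un_disjoint) auto
  also have "\<dots> =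
      (\<Sum>I\<in>Pow A. signed_term A I) * (\<Sum>J\<in>Pow C. of_bool (J = {}) * signed_term C J) -
      (\<Sum>I\<in>Pow A. of_bool (I = {}) * signed_term A I) * (\<Sum>J\<in>Pow C. signed_term C J)"
    unfolding jump_def sum_product sum_subtractf[symmetric]
    by (intro sum.cong refl) (simp add: algebra_simps)
  also have "\<dots> = (\<Prod>i\<in>A. - q i) * (\<Prod>i\<in>C. p i) - (\<Prod>i\<in>A. p i) * (\<Prod>i\<in>C. - q i)"
  proof -
    have "(\<Sum>I\<in>Pow S. of_bool (I = {}) * signed_term S I) = (\<Prod>i\<in>S. p i)" if "finite S" for S
    proof -
      have "(\<Sum>I\<in>Pow S. of_bool (I = {}) * signed_term S I) = (\<Sum>I\<in>{{}}. signed_term S I)"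
        using that by (intro sum.mono_neutral_cong_right) auto
      then show ?thesis by (simp add: signed_term_empty)
    qed
    then show ?thesis using fin by (simp only: sum_signed_term)
  qed
  finally show ?thesis by (simp only: mult.assoc)
qed


section \<open>Exchange of variables\<close>

lemma Flip_0: "Flip A 0 = 0"
  by (simp add: Flip_def substitute_0)

lemma Flip_sum: "Flip A (\<Sum>i\<in>S. g i) = (\<Sum>i\<in>S. Flip A (g i))"
  by (simp add: Flip_def substitute_sum)

lemma Flip_uminus: "Flip A (- y) = - Flip A y"
  using Flip_add[of A y "- y"] by (simp add: Flip_0 eq_neg_iff_add_eq_0 add.commute)

lemma Flip_diff: "Flip A (y - z) = Flip A y - Flip A z"
  using Flip_add[of A y "- z"] by (simp add: Flip_uminus)

lemma Flip_prod: "Flip A (\<Prod>i\<in>S. g i) = (\<Prod>i\<in>S. Flip A (g i))"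
  by (induction S rule: infinite_finite_induct) (simp_all add: Flip_1 Flip_mult)

lemma Flip_minus_one_power: "Flip A ((-1) ^ n) = (-1) ^ n"
  by (induction n) (simp_all add: Flip_1 Flip_mult Flip_uminus)

lemmas Flip_simps = Flip_0 Flip_1 Flip_add Flip_mult Flip_sum Flip_uminus Flip_diff Flip_prod
  Flip_minus_one_power Flip_variable

lemma Flip_signed_term:
  assumes "K \<inter> A = {}" "I \<subseteq> K"
  shows "Flip A (signed_term K I) = signed_term K I"
proof -
  have "(\<Prod>i\<in>I. Flip A (- (p i + q i))) = (\<Prod>i\<in>I. - (p i + q i))"
    using assms by (intro prod.cong) (auto simp: Flip_simps)
  moreover have "(\<Prod>i\<in>K - I. Flip A (p i)) = (\<Prod>i\<in>K - I. p i)"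
    using assms by (intro prod.cong) (auto simp: Flip_simps)
  ultimately show ?thesis unfolding signed_term_def by (simp only: Flip_mult Flip_prod)
qed

text \<open>
  The sum involves only the variables with index in \<open>K\<close>.
\<close>

lemma Flip_wall_sum:
  assumes "K \<inter> A = {}"
  shows "Flip A (wall_sum K \<psi> x) = wall_sum K \<psi> x"
  unfolding wall_sum_def Flip_sum
  by (intro sum.cong refl) (use assms in \<open>auto simp: Flip_mult Flip_signed_term Flip_0 Flip_1 of_bool_def\<close>)


section \<open>Sequences with flipped signs\<close>

lemma wall_sum_cong:
  assumes "\<And>i. i \<in> K \<Longrightarrow> \<psi> i = \<psi>' i"
  shows "wall_sum K \<psi> x = wall_sum K \<psi>' x"
proof -
  have "generated_cone I \<psi> = generated_cone I \<psi>'" if "I \<in> Pow K" for I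
    using that assms by (intro generated_cone_cong) auto
  then show ?thesis unfolding wall_sum_def by (intro sum.cong) auto
qed

lemma flip_seq_flip_seq: "flip_seq A (flip_seq A \<psi>) = \<psi>"
  by (rule ext) (simp add: flip_seq_def)

lemma span_flip_seq: "span (flip_seq A \<psi> ` I) = span (\<psi> ` I)"
proof -
  have sub: "span (flip_seq A \<psi>' ` I) \<subseteq> span (\<psi>' ` I)" for \<psi>' :: "nat \<Rightarrow> 'a"
    by (intro span_minimal subspace_span)
       (auto simp: flip_seq_def intro: span_base[OF imageI] span_neg[OF span_base[OF imageI]])
  show ?thesis using sub[of \<psi>] sub[of "flip_seq A \<psi>"] by (simp add: flip_seq_flip_seq)
qed

lemma independent_family_flip_seq:
  assumes "independent_family J \<psi>"
  shows "independent_family J (flip_seq A \<psi>)"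
  unfolding independent_family_def
proof (intro allI impI)
  fix u assume "(\<Sum>j\<in>J. u j *\<^sub>R flip_seq A \<psi> j) = 0"
  moreover have "(\<Sum>j\<in>J. u j *\<^sub>R flip_seq A \<psi> j) = (\<Sum>j\<in>J. (if j \<in> A then - u j else u j) *\<^sub>R \<psi> j)"
    by (intro sum.cong) (auto simp: flip_seq_def)
  ultimately have "\<forall>j\<in>J. (if j \<in> A then - u j else u j) = 0"
    using assms[unfolded independent_family_def, THEN spec, of "\<lambda>j. if j \<in> A then - u j else u j"]
    by (simp only: simp_thms)
  then show "\<forall>j\<in>J. u j = 0" by (metis neg_equal_0_iff_equal)
qed

text \<open>
  A change of signs affects neither independence nor spans.
\<close>

lemma wall_flip_seq:
  fixes \<psi> :: "nat \<Rightarrow> 'a::euclidean_space"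
  shows "wall N (flip_seq A \<psi>) H \<longleftrightarrow> wall N \<psi> H"
proof -
  have imp: "wall N (flip_seq A \<psi>') H" if H: "wall N \<psi>' H" for \<psi>' :: "nat \<Rightarrow> 'a"
  proof -
    obtain B where B: "B \<subseteq> \<psi>' ` {1..N}" "independent B" "card B = DIM('a) - 1" "H = span B"
      using H unfolding wall_def by blast
    obtain J where J: "J \<subseteq> {1..N}" "inj_on \<psi>' J" "B = \<psi>' ` J"
      using B(1) by (meson subset_image_inj)
    have fin: "finite J" using J(1) finite_subset by blast
    have "independent_family J \<psi>'" using J B(2) fin by (simp add: independent_family_iff)
    then have "independent_family J (flip_seq A \<psi>')" by (rule independent_family_flip_seq)
    then have "inj_on (flip_seq A \<psi>') J" "independent (flip_seq A \<psi>' ` J)"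
      using fin by (simp_all add: independent_family_iff)
    then show ?thesis
      unfolding wall_def using J B(3,4)
      by (intro exI[of _ "flip_seq A \<psi>' ` J"]) (auto simp: card_image span_flip_seq)
  qed
  show ?thesis using imp[of \<psi>] imp[of "flip_seq A \<psi>"] by (auto simp: flip_seq_flip_seq)
qed

lemma tope_flip_seq: "tope N (flip_seq A \<psi>) \<tau> \<longleftrightarrow> tope N \<psi> \<tau>"
  unfolding tope_def wall_flip_seq ..

theorem theorem33:
  fixes N :: nat
    and \<phi> :: "nat \<Rightarrow> 'a::euclidean_space"
    and \<tau>\<^sub>1 \<tau>\<^sub>2 H S :: "'a set"
    and A :: "nat set"
  assumes "\<And>i. i \<in> {1..N} \<Longrightarrow> \<phi> i \<noteq> 0"
    and "span (\<phi> ` {1..N}) = UNIV"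
    and "salient (generated_cone {1..N} \<phi>)"
    and "tope N \<phi> \<tau>\<^sub>1" and "tope N \<phi> \<tau>\<^sub>2"
    and "adjacent N \<phi> \<tau>\<^sub>1 \<tau>\<^sub>2"
    and "\<tau>\<^sub>1 \<subseteq> generated_cone {1..N} \<phi>"
    and "common_wall N \<phi> \<tau>\<^sub>1 \<tau>\<^sub>2 H"
    and "open_side H S" and "\<tau>\<^sub>1 \<subseteq> S"
    and "A = {i \<in> {1..N}. \<phi> i \<in> S}"
  shows "BG_poly N \<phi> \<tau>\<^sub>1 =
    BG_poly N \<phi> \<tau>\<^sub>2 - (-1) ^ card A * Flip A (BG_poly N (flip_seq A \<phi>) \<tau>\<^sub>2)"
proof -
  note span = assms(2) and \<tau> = assms(4,5) and cw = assms(8)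
  obtain f :: "'a \<Rightarrow> real" where f: "linear f" and H: "H = {x. f x = 0}" and S: "S = {x. 0 < f x}"
    using assms(9) unfolding open_side_def by blast
  have pos: "0 < f z" if "z \<in> \<tau>\<^sub>1" for z using assms(10) that S by blast
  have neg: "f z < 0" if "z \<in> \<tau>\<^sub>2" for z
    using common_wall_separates[OF \<tau> cw[unfolded H] f pos that] .
  obtain x where x: "x \<in> closure \<tau>\<^sub>1" "x \<in> closure \<tau>\<^sub>2"
    and only: "\<And>H'. wall N \<phi> H' \<Longrightarrow> x \<in> H' \<Longrightarrow> H' = {z. f z = 0}"
    using common_wall_generic_point[OF \<tau> cw] unfolding H by blast
  define K where "K = {i \<in> {1..N}. f (\<phi> i) = 0}"
  define C where "C = {i \<in> {1..N}. f (\<phi> i) < 0}"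
  have A: "A = {i \<in> {1..N}. 0 < f (\<phi> i)}" unfolding assms(11) S by simp
  then have A_iff: "i \<in> A \<longleftrightarrow> 0 < f (\<phi> i)" if "i \<in> {1..N}" for i using that by simp
  have A_sub: "i \<in> {1..N}" if "i \<in> A" for i using that A by simp
  let ?\<phi> = "flip_seq A \<phi>"
  have f_flip: "f (?\<phi> i) = (if i \<in> A then - f (\<phi> i) else f (\<phi> i))" for i
    by (simp add: flip_seq_def linear_neg[OF f])
  have flip_nonpos: "f (?\<phi> i) \<le> 0" if "i \<in> {1..N}" for i
    using that by (auto simp: f_flip A_iff)
  have flip_sets: "K = {i \<in> {1..N}. f (?\<phi> i) = 0}" "{} = {i \<in> {1..N}. 0 < f (?\<phi> i)}"
    "A \<union> C = {i \<in> {1..N}. f (?\<phi> i) < 0}"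
    by (auto simp: f_flip K_def C_def A_iff split: if_splits dest: A_sub)
  have fin: "finite A" "finite C" and disj: "A \<inter> C = {}" "K \<inter> A = {}"
    unfolding A C_def K_def by auto
  \<comment> \<open>All flipped vectors lie in the closed half-space opposite to \<open>\<tau>\<^sub>1\<close>.\<close>
  have flip0: "BG_poly N ?\<phi> \<tau>\<^sub>1 = 0"
  proof -
    obtain y where y: "y \<in> \<tau>\<^sub>1" using tope_nonempty[OF \<tau>(1)] by blast
    have "\<not> \<tau>\<^sub>1 \<subseteq> generated_cone I ?\<phi>" if "I \<subseteq> {1..N}" for I
      using cone_in_half_space[OF f, of I ?\<phi> y] flip_nonpos that pos[OF y] y by force
    then have "generating_sets N ?\<phi> \<tau>\<^sub>1 = {}" unfolding generating_sets_def by blast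
    then show ?thesis unfolding BG_poly_def by simp
  qed
  let ?Z = "(-1) ^ DIM('a) * wall_sum K \<phi> x"
  have jump: "BG_poly N \<phi> \<tau>\<^sub>1 - BG_poly N \<phi> \<tau>\<^sub>2 =
      ?Z * ((\<Prod>i\<in>A. - q i) * (\<Prod>i\<in>C. p i) - (\<Prod>i\<in>A. p i) * (\<Prod>i\<in>C. - q i))"
    by (rule BG_poly_jump[OF span \<tau> x only f pos neg K_def A C_def])
  have "BG_poly N ?\<phi> \<tau>\<^sub>1 - BG_poly N ?\<phi> \<tau>\<^sub>2 = (-1) ^ DIM('a) * wall_sum K ?\<phi> x *
      ((\<Prod>i\<in>{}. - q i) * (\<Prod>i\<in>A \<union> C. p i) - (\<Prod>i\<in>{}. p i) * (\<Prod>i\<in>A \<union> C. - q i))"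
    by (rule BG_poly_jump[OF _ _ _ x _ f pos neg flip_sets])
       (use span \<tau> only in \<open>simp_all add: span_flip_seq tope_flip_seq wall_flip_seq\<close>)
  moreover have "wall_sum K ?\<phi> x = wall_sum K \<phi> x"
    using disj(2) by (intro wall_sum_cong) (auto simp: flip_seq_def)
  ultimately have "- BG_poly N ?\<phi> \<tau>\<^sub>2 =
      ?Z * ((\<Prod>i\<in>A. p i) * (\<Prod>i\<in>C. p i) - (\<Prod>i\<in>A. - q i) * (\<Prod>i\<in>C. - q i))"
    using flip0 fin disj(1) by (simp add: prod.union_disjoint)
  then have flip2: "BG_poly N ?\<phi> \<tau>\<^sub>2 =
      - (?Z * ((\<Prod>i\<in>A. p i) * (\<Prod>i\<in>C. p i) - (\<Prod>i\<in>A. - q i) * (\<Prod>i\<in>C. - q i)))"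
    by (metis minus_minus)
  have C_fixed: "(\<Prod>i\<in>C. Flip A (p i)) = (\<Prod>i\<in>C. p i)" "(\<Prod>i\<in>C. - Flip A (q i)) = (\<Prod>i\<in>C. - q i)"
    using disj(1) by (auto intro!: prod.cong simp: Flip_simps)
  have A_swapped: "(\<Prod>i\<in>A. Flip A (p i)) = (\<Prod>i\<in>A. q i)" "(\<Prod>i\<in>A. - Flip A (q i)) = (\<Prod>i\<in>A. - p i)"
    by (auto intro!: prod.cong simp: Flip_simps)
  have Flip_X: "Flip A (BG_poly N ?\<phi> \<tau>\<^sub>2) =
      - (?Z * ((\<Prod>i\<in>A. q i) * (\<Prod>i\<in>C. p i) - (\<Prod>i\<in>A. - p i) * (\<Prod>i\<in>C. - q i)))"
    unfolding flip2 Flip_uminus Flip_mult Flip_diff Flip_prod C_fixed A_swapped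
      Flip_minus_one_power Flip_wall_sum[OF disj(2)] ..
  have sign: "(-1) ^ card A * (\<Prod>i\<in>A. q i) = (\<Prod>i\<in>A. - q i)"
    "(-1) ^ card A * (\<Prod>i\<in>A. - p i) = (\<Prod>i\<in>A. p i)"
    by (simp_all add: prod_uminus flip: mult.assoc power_add)
  have distrib: "s * - (z * (a * b - c * d)) = - (z * (s * a * b - s * c * d))" for s z a b c d :: pq_poly
    by (simp add: algebra_simps)
  have "(-1) ^ card A * Flip A (BG_poly N ?\<phi> \<tau>\<^sub>2) =
      - (?Z * ((\<Prod>i\<in>A. - q i) * (\<Prod>i\<in>C. p i) - (\<Prod>i\<in>A. p i) * (\<Prod>i\<in>C. - q i)))"
    unfolding Flip_X distrib sign ..
  then show ?thesis unfolding jump[symmetric] by simp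
qed

end
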